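(* Suppose $\hat Q^r(0)\to\hat Q(0)$ in distribution as $r\to\infty$, where $\hat Q(0)$ is a random vector. Then, for every sequence $K^r=o(\sqrt r)$ with $K^r\to\infty$ as $r\to\infty$, and for every $T>0$ and $\epsilon>0$, $$\mathbb P\left(\sup_{K^r/\sqrt r\le t\le T}\left|\hat Q^r_i(t)-\hat Q^r_j(t)\right|>\epsilon\right)\to0$$ for every $i,j\in\{1,\ldots,S\}$ as $r\to\infty$. If, in addition, for every $i,j\in\{1,\ldots,S\}$, $|\hat Q^r_i(0)-\hat Q^r_j(0)|\to0$ in probability, then $$\mathbb P\left(\sup_{0\le t\le T}\left|\hat Q^r_i(t)-\hat Q^r_j(t)\right|>\epsilon\right)\to0$$ for every $i,j\in\{1,\ldots,S\}$ as $r\to\infty$.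
   Context: Model. There are $S\ge 2$ battery swapping stations and $r$ electric vehicles (EVs); $\lambda,\mu>0$. For unordered pairs $\{i,j\}$ of distinct stations let $p_{ij}=p_{ji}\ge 0$ with $\sum_{\{i,j\}}p_{ij}=1$, and let $p_i=\frac12\sum_{j}p_{ij}$. Let $E=\{\{i,j\}:p_{ij}>0\}$; standing assumption: the graph $(\{1,\ldots,S\},E)$ is connected. Station $i$ has $B_i^r=p_i\left(\frac{\lambda r}{\mu}+\beta\sqrt{\frac{\lambda r}{\mu}}\right)$ spare batteries and $F_i^r=p_i\left(\frac{\lambda r}{\mu}+\gamma\sqrt{\frac{\lambda r}{\mu}}\right)$ charging points, where $\beta\in\mathbb{R}$, $\gamma\le\beta$ (integrality is ignored). Dynamics. Each EV not waiting at a station needs a new battery after an exponential time of rate $\lambda$; then with probability $p_{ij}$ it chooses between stations $i$ and $j$, and goes to the one with the smaller value of $Q_\cdot^r(t)/p_\cdot$ (ties broken evenly), where its battery is instantaneously swapped for a fully-charged one if available, and otherwise the EV waits there for one. Each charge takes an exponential time of rate $\mu$; all times are independent. $Q_i^r(t)$ is the number of batteries in need of charging (being charged or waiting for a charging point) at station $i$ at time $t$. Thus $Q^r=(Q^r_1,\ldots,Q^r_S)$ is a Markov chain where, with $L^r=r-\sum_j(Q^r_j-B^r_j)^+$ the number of EVs not waiting, $Q_i^r$ increases by one at rate $\lambda L^r\sum_{j}p_{ij}\left(\mathbf 1\{Q^r_i/p_i<Q^r_j/p_j\}+\frac12\mathbf 1\{Q^r_i/p_i=Q^r_j/p_j\}\right)$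 and decreases by one at rate $\mu\min\{Q^r_i,F^r_i\}$. Diffusion scaling: $\hat Q^r_i(t)=\dfrac{Q^r_i(t)-p_i\lambda r/\mu}{p_i\sqrt{\lambda r/\mu}}$, $i=1,\ldots,S$. *)

theory Defs
  imports "HOL-Probability.Probability" "HOL-Library.Landau_Symbols"
begin

section \<open>Continuous-time Markov chains with given jump rates\<close>

text \<open>
  A transition semigroup on \<^typ>\<open>'x\<close> is a family of stochastic kernels. Its jump rate from
  \<^term>\<open>x\<close> to \<^term>\<open>y \<noteq> x\<close> is the right derivative at 0 of the transition probability; the
  derivative on the diagonal is minus the total jump rate out of \<^term>\<open>x\<close>. For bounded
  \<^term>\<open>q\<close> the semigroup is determined by these conditions. Values \<^term>\<open>q x x\<close> are ignored.
\<close>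

definition transition_semigroup :: "(real \<Rightarrow> 'x \<Rightarrow> 'x pmf) \<Rightarrow> bool" where
  "transition_semigroup P \<longleftrightarrow>
     (\<forall>x. P 0 x = return_pmf x) \<and>
     (\<forall>s\<ge>0. \<forall>t\<ge>0. \<forall>x. P (s + t) x = bind_pmf (P s x) (P t))"

definition has_jump_rates :: "(real \<Rightarrow> 'x \<Rightarrow> 'x pmf) \<Rightarrow> ('x \<Rightarrow> 'x \<Rightarrow> real) \<Rightarrow> bool" where
  "has_jump_rates P q \<longleftrightarrow>
     (\<forall>x. q x summable_on (UNIV - {x}) \<and>
          ((\<lambda>t. pmf (P t x) x) has_real_derivative - infsum (q x) (UNIV - {x})) (at 0 within {0..}) \<and>
          (\<forall>y. y \<noteq> x \<longrightarrow> ((\<lambda>t. pmf (P t x) y) has_real_derivative q x y) (at 0 within {0..})))"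

definition cadlag_paths :: "'w measure \<Rightarrow> (real \<Rightarrow> 'w \<Rightarrow> 'x) \<Rightarrow> bool" where
  "cadlag_paths M X \<longleftrightarrow>
     (\<forall>\<omega>\<in>space M. \<forall>t\<ge>0.
        (\<forall>\<^sub>F s in at_right t. X s \<omega> = X t \<omega>) \<and>
        (t > 0 \<longrightarrow> (\<exists>x. \<forall>\<^sub>F s in at_left t. X s \<omega> = x)))"

text \<open>
  Right-continuity and left limits above are with respect to the discrete topology on the state
  space. The Markov property is expressed through the finite-dimensional distributions; the
  initial distribution is arbitrary.
\<close>

definition markov_jump_process ::
    "'w measure \<Rightarrow> (real \<Rightarrow> 'w \<Rightarrow> 'x::countable) \<Rightarrow> ('x \<Rightarrow> 'x \<Rightarrow> real) \<Rightarrow> bool" where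
  "markov_jump_process M X q \<longleftrightarrow>
     prob_space M \<and>
     (\<forall>t\<ge>0. X t \<in> measurable M (count_space UNIV)) \<and>
     cadlag_paths M X \<and>
     (\<exists>P. transition_semigroup P \<and> has_jump_rates P q \<and>
        (\<forall>n (\<tau> :: nat \<Rightarrow> real) x.
           0 \<le> \<tau> 0 \<and> (\<forall>k<n. \<tau> k \<le> \<tau> (Suc k)) \<longrightarrow>
           \<P>(\<omega> in M. \<forall>k\<le>n. X (\<tau> k) \<omega> = x k) =
           \<P>(\<omega> in M. X (\<tau> 0) \<omega> = x 0) *
             (\<Prod>k<n. pmf (P (\<tau> (Suc k) - \<tau> k) (x k)) (x (Suc k)))))"

section \<open>Convergence of random variables on varying probability spaces\<close>

definition conv_in_distribution ::
    "(nat \<Rightarrow> 'w measure) \<Rightarrow> (nat \<Rightarrow> 'w \<Rightarrow> 'b::topological_space) \<Rightarrow> 'v measure \<Rightarrow> ('v \<Rightarrow> 'b) \<Rightarrow> bool" where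
  "conv_in_distribution M X N Y \<longleftrightarrow>
     (\<forall>f :: 'b \<Rightarrow> real. continuous_on UNIV f \<and> bounded (range f) \<longrightarrow>
        (\<lambda>r. \<integral>\<omega>. f (X r \<omega>) \<partial>M r) \<longlonglongrightarrow> (\<integral>\<omega>. f (Y \<omega>) \<partial>N))"

definition conv_in_probability_0 :: "(nat \<Rightarrow> 'w measure) \<Rightarrow> (nat \<Rightarrow> 'w \<Rightarrow> real) \<Rightarrow> bool" where
  "conv_in_probability_0 M X \<longleftrightarrow>
     (\<forall>\<delta>>0. (\<lambda>r. \<P>(\<omega> in M r. \<bar>X r \<omega>\<bar> > \<delta>)) \<longlonglongrightarrow> 0)"

section \<open>The battery swapping network\<close>

text \<open>
  Stations are the elements of a finite type \<^typ>\<open>'s\<close>. The probability $p_{ij} = p_{ji}$ of the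
  unordered pair of distinct stations \<^term>\<open>i\<close>, \<^term>\<open>j\<close> is \<^term>\<open>p {i, j}\<close>; values of
  \<^term>\<open>p\<close> at sets that are not of this form play no role.
\<close>

definition station_pairs :: "'s set set" where
  "station_pairs = {{i, j} |i j. i \<noteq> j}"

definition pair_graph_connected :: "('s set \<Rightarrow> real) \<Rightarrow> bool" where
  "pair_graph_connected p \<longleftrightarrow> (\<forall>i j. (i, j) \<in> {(a, b). a \<noteq> b \<and> p {a, b} > 0}\<^sup>*)"

definition station_prob :: "('s::finite set \<Rightarrow> real) \<Rightarrow> 's \<Rightarrow> real" where
  "station_prob p i = (1/2) * (\<Sum>j\<in>UNIV - {i}. p {i, j})"

definition spare_batteries :: "('s::finite set \<Rightarrow> real) \<Rightarrow> real \<Rightarrow> real \<Rightarrow> real \<Rightarrow> nat \<Rightarrow> 's \<Rightarrow> real" where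
  "spare_batteries p lam mu \<beta> r i =
     station_prob p i * (lam * real r / mu + \<beta> * sqrt (lam * real r / mu))"

definition charging_points :: "('s::finite set \<Rightarrow> real) \<Rightarrow> real \<Rightarrow> real \<Rightarrow> real \<Rightarrow> nat \<Rightarrow> 's \<Rightarrow> real" where
  "charging_points p lam mu \<gamma> r i =
     station_prob p i * (lam * real r / mu + \<gamma> * sqrt (lam * real r / mu))"

definition non_waiting_EVs ::
    "('s::finite set \<Rightarrow> real) \<Rightarrow> real \<Rightarrow> real \<Rightarrow> real \<Rightarrow> nat \<Rightarrow> nat ^ 's \<Rightarrow> real" where
  "non_waiting_EVs p lam mu \<beta> r x =
     real r - (\<Sum>j\<in>UNIV. max 0 (real (x $ j) - spare_batteries p lam mu \<beta> r j))"

text \<open>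
  Since the numbers of spare batteries and charging points are not rounded to integers, the
  number of non-waiting EVs can become (slightly) negative; likewise the number of charging
  points is negative for small \<^term>\<open>r\<close> when \<^term>\<open>\<gamma> < 0\<close>. Rates are therefore truncated at 0.
\<close>

definition arrival_rate ::
    "('s::finite set \<Rightarrow> real) \<Rightarrow> real \<Rightarrow> real \<Rightarrow> real \<Rightarrow> nat \<Rightarrow> nat ^ 's \<Rightarrow> 's \<Rightarrow> real" where
  "arrival_rate p lam mu \<beta> r x i =
     lam * max 0 (non_waiting_EVs p lam mu \<beta> r x) *
     (\<Sum>j\<in>UNIV - {i}. p {i, j} *
        (of_bool (real (x $ i) / station_prob p i < real (x $ j) / station_prob p j) +
         1/2 * of_bool (real (x $ i) / station_prob p i = real (x $ j) / station_prob p j)))"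

definition charging_rate ::
    "('s::finite set \<Rightarrow> real) \<Rightarrow> real \<Rightarrow> real \<Rightarrow> real \<Rightarrow> nat \<Rightarrow> nat ^ 's \<Rightarrow> 's \<Rightarrow> real" where
  "charging_rate p lam mu \<gamma> r x i =
     mu * max 0 (min (real (x $ i)) (charging_points p lam mu \<gamma> r i))"

definition queue_rates ::
    "('s::finite set \<Rightarrow> real) \<Rightarrow> real \<Rightarrow> real \<Rightarrow> real \<Rightarrow> real \<Rightarrow> nat \<Rightarrow> nat ^ 's \<Rightarrow> nat ^ 's \<Rightarrow> real" where
  "queue_rates p lam mu \<beta> \<gamma> r x y =
     (\<Sum>i\<in>UNIV. of_bool (y = x + axis i 1) * arrival_rate p lam mu \<beta> r x i +
                of_bool (x = y + axis i 1) * charging_rate p lam mu \<gamma> r x i)"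

definition diffusion_scaled ::
    "('s::finite set \<Rightarrow> real) \<Rightarrow> real \<Rightarrow> real \<Rightarrow> nat \<Rightarrow> nat ^ 's \<Rightarrow> real ^ 's" where
  "diffusion_scaled p lam mu r x =
     (\<chi> i. (real (x $ i) - station_prob p i * lam * real r / mu) /
           (station_prob p i * sqrt (lam * real r / mu)))"

end

theory Submission
  imports Defs
begin

text \<open>
  Write $q_i$ for the scaled queue lengths, $w_i$ for the weight \<^term>\<open>station_prob p i\<close> of station
  $i$, $m = \sum_i w_i q_i$ for their mean, and $V = \sum_i w_i (q_i - m)^2$ for their spread. The
  theorem says that $V$ becomes small within a time of order $1/\sqrt r$ and stays small.

  The reason is a strong negative drift of $V$. An EV that chooses between $i$ and $j$ joins the smaller of
  the two queues, and $\min(q_i, q_j) = (q_i + q_j - |q_i - q_j|)/2$; summed over the pairs, the first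
  part leaves the spread unchanged and the second decreases it, at a rate of order
  $\sqrt r \sum p_{ij} |q_i - q_j|$. Since the graph of pairs is connected, this sum is at least a
  constant times $\sqrt V$. Departures can only help, because the charging rate divided by $w_i$ is the
  same nondecreasing function of $q_i$ at all stations. The remaining contribution is noise: there are
  order $r$ jumps per unit of time and each moves $q$ by order $1/\sqrt r$, which adds $O(1)$ to the
  drift of $V$. That is too much to control a whole interval $[0,T]$ with $V$ itself, but for
  $V^2$ it gives the drift bound $- c \sqrt r\, V^{3/2} + C V + C/r$, which is at most $C'/r$ everywhere
  and at most $- \kappa (\sqrt r/b) V^2 + C'/r$ as long as $V \le b^2$ (lemma \<open>drift_spread_sq\<close>
  and the proof of \<open>spread_hitting\<close>).

  All this requires that a fixed fraction of the EVs is not waiting. If the excess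
  $G = \sum_i w_i ((q_i - \gamma)^+)^2$ is at most a certain multiple of $r$, then at least half of
  the EVs are not waiting; and there $G$ has a drift of order at most $\sqrt r$, so that $G/r$, which
  starts near $0$, stays small on $[0,T]$ (lemmas \<open>demand_rate_ge\<close> and \<open>drift_excess\<close>).

  Drift bounds turn into bounds on hitting probabilities by a supermartingale argument (lemma
  \<open>markov_jump_process_hitting\<close>), applied to
  $\min(1, V^2/b^4 + G/(\alpha r) + e^{-\kappa (\sqrt r/b) (t_0 - t)^+} V^2/\epsilon^2)$ at time $t$.
  The first two terms detect the exit from the region in which the drift bounds hold, and the
  exponential uses the fast decay of $V^2$ before $t_0$. Only its value at time $0$ and an error
  $O(1/\sqrt r)$ enter the bound. The initial states are tight, hence with
  $t_0 = K^r/\sqrt r$ and $b = \sqrt{K^r}$ that value tends to $0$, the exponential being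
  $e^{-\kappa \sqrt{K^r}}$. With $t_0 = 0$ and $b = r$ it tends to $0$ if the spread at time $0$
  does.

  The supermartingale argument works directly with the finite-dimensional distributions: on a grid of
  mesh $\delta$ the process is a discrete Markov chain, and since the functions used are capped at $1$,
  the derivatives of the transition probabilities at time $0$ determine the one-step expectations up to
  $o(\delta)$, uniformly over all such functions. Right-continuity then passes from dyadic grids to all
  times.
\<close>

section \<open>Drift of a function under jump rates\<close>

definition jump_drift :: "('x \<Rightarrow> 'x \<Rightarrow> real) \<Rightarrow> ('x \<Rightarrow> real) \<Rightarrow> 'x \<Rightarrow> real" where
  "jump_drift q f x = (\<Sum>y | y \<noteq> x \<and> q x y \<noteq> 0. q x y * (f y - f x))"

lemma jump_drift_add_scaled:
  "jump_drift q (\<lambda>y. f y + a * g y) x = jump_drift q f x + a * jump_drift q g x"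
  unfolding jump_drift_def
  by (simp add: algebra_simps sum.distrib sum_subtractf sum_distrib_left)

lemma jump_drift_scaled: "jump_drift q (\<lambda>y. a * g y) x = a * jump_drift q g x"
  using jump_drift_add_scaled[of q "\<lambda>_. 0" a g x] by (simp add: jump_drift_def)

text \<open>
  An Euler step $f + \delta\, A f$ of the generator is an average of values of $f$ once $\delta$ times
  the total jump rate is at most $1$. So a function capped at $1$ may be replaced by the uncapped one,
  whose drift is easy to bound.
\<close>

lemma euler_step_mono:
  assumes q: "\<And>y. y \<noteq> x \<Longrightarrow> 0 \<le> q x y"
    and \<delta>: "0 \<le> \<delta>" "\<delta> * (\<Sum>y | y \<noteq> x \<and> q x y \<noteq> 0. q x y) \<le> 1"
    and fg: "\<And>y. f y \<le> g y"
  shows "f x + \<delta> * jump_drift q f x \<le> g x + \<delta> * jump_drift q g x"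
proof -
  define N where "N = {y. y \<noteq> x \<and> q x y \<noteq> 0}"
  have eq: "h x + \<delta> * jump_drift q h x = (1 - \<delta> * sum (q x) N) * h x + \<delta> * (\<Sum>y\<in>N. q x y * h y)" for h
    unfolding jump_drift_def N_def[symmetric]
    by (simp add: algebra_simps sum_subtractf sum_distrib_left)
  have "(1 - \<delta> * sum (q x) N) * f x \<le> (1 - \<delta> * sum (q x) N) * g x"
    using \<delta> fg by (intro mult_left_mono) (auto simp: N_def)
  moreover have "\<delta> * (\<Sum>y\<in>N. q x y * f y) \<le> \<delta> * (\<Sum>y\<in>N. q x y * g y)"
    using \<delta> fg q by (intro mult_left_mono sum_mono) (auto simp: N_def)
  ultimately show ?thesis unfolding eq by linarith
qed

section \<open>Hitting bound for Markov jump processes\<close>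

text \<open>
  The values off the finite set are estimated by $1$; no sum over infinitely many states remains.
\<close>

lemma pmf_expectation_le_finite:
  fixes g :: "'x \<Rightarrow> real"
  assumes g: "\<And>y. 0 \<le> g y" "\<And>y. g y \<le> 1" and F: "finite F"
  shows "measure_pmf.expectation A g \<le> 1 + (\<Sum>y\<in>F. (g y - 1) * pmf A y)"
proof -
  have int: "integrable (measure_pmf A) g"
    by (rule measure_pmf.integrable_const_bound[where B=1]) (use g in auto)
  have int': "integrable (measure_pmf A) (\<lambda>y. (g y - 1) * indicator F y)"
    by (rule measure_pmf.integrable_const_bound[where B=1])
       (use g in \<open>auto simp: indicator_def abs_le_iff intro: order_trans[OF g(2)]\<close>)
  have "measure_pmf.expectation A g - 1 = measure_pmf.expectation A (\<lambda>y. g y - 1)"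
    using int by (simp add: Bochner_Integration.integral_diff)
  also have "\<dots> \<le> measure_pmf.expectation A (\<lambda>y. (g y - 1) * indicator F y)"
    using int int' by (intro integral_mono) (auto simp: indicator_def g)
  also have "\<dots> = (\<Sum>y\<in>F. (g y - 1) * pmf A y)"
    by (subst integral_measure_pmf_real[OF F]) (auto simp: indicator_def)
  finally show ?thesis by simp
qed

text \<open>
  The rates exhaust the derivative of the probability of staying at the state, so a jump to a state
  outside the finite set of possible targets has probability $o(\delta)$. The error in the first-order
  expansion is therefore bounded by a quantity that involves only finitely many transition
  probabilities and not the function: the order of quantifiers matters, as the function varies with the
  step size in the application.
\<close>

lemma small_time_expectation:
  assumes P: "transition_semigroup P" "has_jump_rates P q"
    and fin: "finite {y. y \<noteq> x \<and> q x y \<noteq> 0}" and \<eta>: "\<eta> > 0"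
  shows "\<forall>\<^sub>F \<delta> in at_right 0. \<forall>g. (\<forall>y. 0 \<le> g y \<and> g y \<le> 1) \<longrightarrow>
           measure_pmf.expectation (P \<delta> x) g \<le> g x + \<delta> * jump_drift q g x + \<eta> * \<delta>"
proof -
  define N where "N = {y. y \<noteq> x \<and> q x y \<noteq> 0}"
  define R where "R = (\<Sum>y\<in>N. q x y)"
  have finN: "finite N" and xN: "x \<notin> N" using fin by (auto simp: N_def)
  have P0: "P 0 x = return_pmf x" using P by (auto simp: transition_semigroup_def)
  have R: "infsum (q x) (UNIV - {x}) = R"
  proof -
    have "infsum (q x) (UNIV - {x}) = infsum (q x) N"
      by (rule infsum_cong_neutral) (auto simp: N_def)
    then show ?thesis using finN by (simp add: R_def)
  qed
  \<comment> \<open>Errors of the difference quotients at time 0.\<close>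
  define ex where "ex \<delta> = (pmf (P \<delta> x) x - 1) / \<delta> + R" for \<delta>
  define ey where "ey y \<delta> = pmf (P \<delta> x) y / \<delta> - q x y" for y \<delta>
  have ex: "(ex \<longlongrightarrow> 0) (at_right 0)"
  proof -
    have "((\<lambda>t. pmf (P t x) x) has_real_derivative - R) (at 0 within {0..})"
      using P(2) R unfolding has_jump_rates_def by metis
    then have "((\<lambda>t. pmf (P t x) x) has_real_derivative - R) (at_right 0)"
      by (rule DERIV_subset) auto
    then have "((\<lambda>\<delta>. (pmf (P \<delta> x) x - 1) / \<delta>) \<longlongrightarrow> - R) (at_right 0)"
      by (simp add: has_field_derivative_iff P0)
    from tendsto_add[OF this tendsto_const[of R]] show ?thesis by (simp add: ex_def[abs_def])
  qed
  have ey: "(ey y \<longlongrightarrow> 0) (at_right 0)" if "y \<in> N" for y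
  proof -
    have "((\<lambda>t. pmf (P t x) y) has_real_derivative q x y) (at 0 within {0..})"
      using P(2) that unfolding has_jump_rates_def N_def by blast
    then have "((\<lambda>t. pmf (P t x) y) has_real_derivative q x y) (at_right 0)"
      by (rule DERIV_subset) auto
    then have "((\<lambda>\<delta>. pmf (P \<delta> x) y / \<delta>) \<longlongrightarrow> q x y) (at_right 0)"
      using that xN by (auto simp: has_field_derivative_iff P0 indicator_def N_def)
    from tendsto_diff[OF this tendsto_const[of "q x y"]] show ?thesis
      by (simp add: ey_def[abs_def])
  qed
  have "((\<lambda>\<delta>. \<bar>ex \<delta>\<bar> + (\<Sum>y\<in>N. \<bar>ey y \<delta>\<bar>)) \<longlongrightarrow> \<bar>0\<bar> + (\<Sum>y\<in>N. \<bar>0\<bar>)) (at_right 0)"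
    by (intro tendsto_intros ex ey)
  then have "\<forall>\<^sub>F \<delta> in at_right 0. \<bar>ex \<delta>\<bar> + (\<Sum>y\<in>N. \<bar>ey y \<delta>\<bar>) < \<eta>"
    using \<eta> by (intro order_tendstoD) auto
  then show ?thesis
    using eventually_at_right_less[of 0]
  proof eventually_elim
    case (elim \<delta>)
    show ?case
    proof (intro allI impI)
      fix g :: "'a \<Rightarrow> real" assume g: "\<forall>y. 0 \<le> g y \<and> g y \<le> 1"
      have pxx: "pmf (P \<delta> x) x = 1 - \<delta> * R + \<delta> * ex \<delta>"
        using elim(2) by (simp add: ex_def field_simps)
      have pxy: "pmf (P \<delta> x) y = \<delta> * q x y + \<delta> * ey y \<delta>" for y
        using elim(2) by (simp add: ey_def field_simps)
      have b: "(g y - 1) * e \<le> \<bar>e\<bar>" for y e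
      proof -
        have "\<bar>g y - 1\<bar> * \<bar>e\<bar> \<le> 1 * \<bar>e\<bar>"
          using g by (intro mult_right_mono) (auto simp: abs_le_iff intro: order_trans[of "g y" 1])
        then show ?thesis using abs_ge_self[of "(g y - 1) * e"] by (simp add: abs_mult)
      qed
      have "measure_pmf.expectation (P \<delta> x) g
              \<le> 1 + (\<Sum>y\<in>insert x N. (g y - 1) * pmf (P \<delta> x) y)"
        using g finN by (intro pmf_expectation_le_finite) auto
      also have "\<dots> = g x + \<delta> * ((1 - g x) * R + (\<Sum>y\<in>N. (g y - 1) * q x y))
                     + \<delta> * ((g x - 1) * ex \<delta> + (\<Sum>y\<in>N. (g y - 1) * ey y \<delta>))"
      proof -
        have "(\<Sum>y\<in>N. (g y - 1) * pmf (P \<delta> x) y)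
                = \<delta> * (\<Sum>y\<in>N. (g y - 1) * q x y) + \<delta> * (\<Sum>y\<in>N. (g y - 1) * ey y \<delta>)"
          by (simp add: pxy sum_distrib_left sum.distrib[symmetric] algebra_simps)
        then show ?thesis
          unfolding sum.insert[OF finN xN] pxx by (simp add: algebra_simps)
      qed
      also have "(1 - g x) * R + (\<Sum>y\<in>N. (g y - 1) * q x y) = jump_drift q g x"
        unfolding R_def jump_drift_def N_def[symmetric]
        by (simp add: sum_distrib_left sum.distrib[symmetric] algebra_simps)
      also have "(g x - 1) * ex \<delta> + (\<Sum>y\<in>N. (g y - 1) * ey y \<delta>) \<le> \<eta>"
        using elim(1) b[of x "ex \<delta>"] sum_mono[of N "\<lambda>y. (g y - 1) * ey y \<delta>", OF b] by linarith
      finally show "measure_pmf.expectation (P \<delta> x) g \<le> g x + \<delta> * jump_drift q g x + \<eta> * \<delta>"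
        using elim(2) by (simp add: mult.commute)
    qed
  qed
qed

lemma emeasure_split_countable:
  assumes Y: "Y \<in> measurable M (count_space (UNIV :: 'x::countable set))" and A: "A \<in> sets M"
  shows "emeasure M A = (\<integral>\<^sup>+y. emeasure M {\<omega>\<in>A. Y \<omega> = y} \<partial>count_space UNIV)"
proof -
  have m: "{\<omega>\<in>A. Y \<omega> = y} \<in> sets M" for y
  proof -
    have "{\<omega>\<in>A. Y \<omega> = y} = A \<inter> (Y -` {y} \<inter> space M)"
      using sets.sets_into_space[OF A] by auto
    also have "\<dots> \<in> sets M"
      using A measurable_sets[OF Y, of "{y}"] by auto
    finally show ?thesis .
  qed
  have "emeasure M (\<Union>y\<in>UNIV. {\<omega>\<in>A. Y \<omega> = y}) =
          (\<integral>\<^sup>+y. emeasure M {\<omega>\<in>A. Y \<omega> = y} \<partial>count_space UNIV)"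
    by (rule emeasure_UN_countable) (auto simp: disjoint_family_on_def m)
  also have "(\<Union>y\<in>UNIV. {\<omega>\<in>A. Y \<omega> = y}) = A" by auto
  finally show ?thesis .
qed

text \<open>
  Optional stopping for the supermartingale $F_k(Y_k) - k \eta$, by backward induction over the time $m$: the
  claim is proved for the paths with a given history up to time $m$, because the finite-dimensional
  distributions give the probability of a history, and the events that extend a history by one state are
  disjoint.
\<close>

lemma hitting_probability_le:
  fixes Y :: "nat \<Rightarrow> 'w \<Rightarrow> 'x::countable" and n :: nat and \<eta> :: real
  assumes M: "prob_space M"
    and Y: "\<And>k. Y k \<in> measurable M (count_space UNIV)"
    and fdd: "\<And>n x. \<P>(\<omega> in M. \<forall>k\<le>n. Y k \<omega> = x k) =
                \<P>(\<omega> in M. Y 0 \<omega> = x 0) * (\<Prod>k<n. pmf (K (x k)) (x (Suc k)))"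
    and F: "\<And>k x. 0 \<le> F k x" "\<And>k x. F k x \<le> 1"
    and hit: "\<And>k x. x \<in> B k \<Longrightarrow> F k x = 1"
    and step: "\<And>k x. k < n \<Longrightarrow> measure_pmf.expectation (K x) (F (Suc k)) \<le> F k x + \<eta>"
    and \<eta>: "0 \<le> \<eta>"
  shows "\<P>(\<omega> in M. \<exists>k\<le>n. Y k \<omega> \<in> B k) \<le> (\<integral>\<omega>. F 0 (Y 0 \<omega>) \<partial>M) + real n * \<eta>"
proof -
  interpret prob_space M by (rule M)
  note [measurable] = Y
  define H where "H m x = {\<omega>\<in>space M. \<forall>k\<le>m. Y k \<omega> = x k}" for m and x :: "nat \<Rightarrow> 'x"
  define D where "D m = {\<omega>\<in>space M. \<exists>k\<in>{m..n}. Y k \<omega> \<in> B k}" for m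
  have Hm [measurable]: "H m x \<in> sets M" for m x unfolding H_def by measurable
  have Dm [measurable]: "D m \<in> sets M" for m unfolding D_def by measurable
  have Hsuc: "emeasure M (H (Suc m) (x(Suc m := y))) = emeasure M (H m x) * ennreal (pmf (K (x m)) y)"
    for m x y
  proof -
    have "prob (H (Suc m) (x(Suc m := y))) = prob (H m x) * pmf (K (x m)) y"
      unfolding H_def fdd by (simp add: mult.assoc)
    then show ?thesis by (simp add: emeasure_eq_measure ennreal_mult)
  qed
  have main: "emeasure M (H m x \<inter> D m) \<le> emeasure M (H m x) * ennreal (F m (x m) + real (n - m) * \<eta>)"
    if "m \<le> n" for m x
    using that
  proof (induction m arbitrary: x rule: inc_induct)
    case base
    show ?case
    proof (cases "x n \<in> B n")
      case True
      then show ?thesis using hit[OF True] by (auto intro!: emeasure_mono)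
    next
      case False
      then have "H n x \<inter> D n = {}" by (auto simp: H_def D_def)
      then show ?thesis by simp
    qed
  next
    case (step m)
    show ?case
    \<comment> \<open>On the target set the claim is trivial, as the function equals 1 there.\<close>
    proof (cases "x m \<in> B m")
      case True
      have "emeasure M (H m x \<inter> D m) \<le> emeasure M (H m x) * 1" by (auto intro!: emeasure_mono)
      also have "\<dots> \<le> emeasure M (H m x) * ennreal (F m (x m) + real (n - m) * \<eta>)"
        using hit[OF True] \<eta> by (intro mult_left_mono) (auto simp flip: ennreal_1 intro!: ennreal_leI)
      finally show ?thesis .
    next
      case False
      let ?e = "real (n - Suc m) * \<eta>"
      have "H m x \<inter> D m = H m x \<inter> D (Suc m)"
      proof -
        have "Y k \<omega> \<in> B k \<longrightarrow> k \<noteq> m" if "\<omega> \<in> H m x" for k \<omega>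
          using that False by (auto simp: H_def)
        then have "\<omega> \<in> D m \<longleftrightarrow> \<omega> \<in> D (Suc m)" if "\<omega> \<in> H m x" for \<omega>
          using that \<open>m < n\<close> by (auto simp: D_def simp flip: atLeastAtMost_insertL[of m n])
        then show ?thesis by blast
      qed
      then have "emeasure M (H m x \<inter> D m) =
          (\<integral>\<^sup>+y. emeasure M {\<omega>\<in>H m x \<inter> D (Suc m). Y (Suc m) \<omega> = y} \<partial>count_space UNIV)"
        using emeasure_split_countable[OF Y[of "Suc m"], of "H m x \<inter> D (Suc m)"] by simp
      also have "\<dots> = (\<integral>\<^sup>+y. emeasure M (H (Suc m) (x(Suc m := y)) \<inter> D (Suc m)) \<partial>count_space UNIV)"
      proof (intro nn_integral_cong arg_cong[where f="emeasure M"])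
        fix y
        have "(\<forall>k\<le>Suc m. Y k \<omega> = (x(Suc m := y)) k) \<longleftrightarrow> (\<forall>k\<le>m. Y k \<omega> = x k) \<and> Y (Suc m) \<omega> = y" for \<omega>
          by (auto simp: le_Suc_eq)
        then have "{\<omega>\<in>H m x. Y (Suc m) \<omega> = y} = H (Suc m) (x(Suc m := y))"
          by (auto simp: H_def)
        then show "{\<omega>\<in>H m x \<inter> D (Suc m). Y (Suc m) \<omega> = y} = H (Suc m) (x(Suc m := y)) \<inter> D (Suc m)"
          by auto
      qed
      also have "\<dots> \<le> (\<integral>\<^sup>+y. emeasure M (H (Suc m) (x(Suc m := y))) *
                           ennreal (F (Suc m) y + ?e) \<partial>count_space UNIV)"
        by (intro nn_integral_mono) (use step.IH[of "x(Suc m := y)" for y] in \<open>simp del: fun_upd_apply add: fun_upd_same\<close>)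
      also have "\<dots> = emeasure M (H m x) * (\<integral>\<^sup>+y. ennreal (F (Suc m) y + ?e) \<partial>K (x m))"
        by (simp add: Hsuc nn_integral_measure_pmf nn_integral_cmult[symmetric] mult.assoc)
      also have "(\<integral>\<^sup>+y. ennreal (F (Suc m) y + ?e) \<partial>K (x m)) =
                   ennreal (measure_pmf.expectation (K (x m)) (\<lambda>y. F (Suc m) y + ?e))"
        using F \<eta> by (intro nn_integral_eq_integral measure_pmf.integrable_const_bound[where B="1 + ?e"])
                  (auto intro!: AE_pmfI add_mono simp: abs_of_nonneg)
      also have "measure_pmf.expectation (K (x m)) (\<lambda>y. F (Suc m) y + ?e)
                   = measure_pmf.expectation (K (x m)) (F (Suc m)) + ?e"
        using F by (subst Bochner_Integration.integral_add)
                 (auto intro!: measure_pmf.integrable_const_bound[where B=1])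
      also have "ennreal \<dots> \<le> ennreal (F m (x m) + real (n - m) * \<eta>)"
        using assms(7)[of m "x m"] \<open>m < n\<close>
        by (intro ennreal_leI) (simp add: algebra_simps of_nat_diff)
      finally show ?thesis by (simp add: mult_left_mono)
    qed
  qed
  have "emeasure M (D 0) = (\<integral>\<^sup>+y. emeasure M {\<omega>\<in>D 0. Y 0 \<omega> = y} \<partial>count_space UNIV)"
    by (rule emeasure_split_countable[OF Y Dm])
  also have "\<dots> \<le> (\<integral>\<^sup>+y. \<integral>\<^sup>+\<omega>. ennreal (F 0 (Y 0 \<omega>) + real n * \<eta>) * indicator {\<omega>\<in>space M. Y 0 \<omega> = y} \<omega> \<partial>M \<partial>count_space UNIV)"
  proof (intro nn_integral_mono)
    fix y
    have "emeasure M {\<omega>\<in>D 0. Y 0 \<omega> = y} = emeasure M (H 0 (\<lambda>_. y) \<inter> D 0)"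
      by (intro arg_cong[where f="emeasure M"]) (auto simp: H_def D_def)
    also have "\<dots> \<le> emeasure M (H 0 (\<lambda>_. y)) * ennreal (F 0 y + real n * \<eta>)"
      using main[of 0 "\<lambda>_. y"] by simp
    also have "\<dots> = (\<integral>\<^sup>+\<omega>. ennreal (F 0 y + real n * \<eta>) * indicator (H 0 (\<lambda>_. y)) \<omega> \<partial>M)"
      by (subst nn_integral_cmult_indicator) (auto simp: mult.commute)
    also have "\<dots> = (\<integral>\<^sup>+\<omega>. ennreal (F 0 (Y 0 \<omega>) + real n * \<eta>) * indicator {\<omega>\<in>space M. Y 0 \<omega> = y} \<omega> \<partial>M)"
      by (intro nn_integral_cong) (auto simp: H_def indicator_def)
    finally show "emeasure M {\<omega>\<in>D 0. Y 0 \<omega> = y} \<le> \<dots>" .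
  qed
  also have "\<dots> = (\<integral>\<^sup>+\<omega>. ennreal (F 0 (Y 0 \<omega>) + real n * \<eta>) \<partial>M)"
  proof -
    have "(\<integral>\<^sup>+y. \<integral>\<^sup>+\<omega>. ennreal (F 0 (Y 0 \<omega>) + real n * \<eta>) * indicator {\<omega>\<in>space M. Y 0 \<omega> = y} \<omega> \<partial>M \<partial>count_space UNIV)
        = (\<integral>\<^sup>+y. emeasure (density M (\<lambda>\<omega>. ennreal (F 0 (Y 0 \<omega>) + real n * \<eta>))) {\<omega>\<in>space M. Y 0 \<omega> = y} \<partial>count_space UNIV)"
      by (intro nn_integral_cong) (simp add: emeasure_density)
    also have "\<dots> = emeasure (density M (\<lambda>\<omega>. ennreal (F 0 (Y 0 \<omega>) + real n * \<eta>))) (space M)"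
      by (subst emeasure_split_countable[where Y="Y 0"]) auto
    also have "\<dots> = (\<integral>\<^sup>+\<omega>. ennreal (F 0 (Y 0 \<omega>) + real n * \<eta>) \<partial>M)"
      by (subst emeasure_density) (auto intro!: nn_integral_cong)
    finally show ?thesis .
  qed
  also have "\<dots> = ennreal (\<integral>\<omega>. F 0 (Y 0 \<omega>) + real n * \<eta> \<partial>M)"
    using F \<eta> by (intro nn_integral_eq_integral integrable_const_bound[where B="1 + real n * \<eta>"])
               (auto intro!: add_mono AE_I2 simp: abs_of_nonneg)
  also have "(\<integral>\<omega>. F 0 (Y 0 \<omega>) + real n * \<eta> \<partial>M) = (\<integral>\<omega>. F 0 (Y 0 \<omega>) \<partial>M) + real n * \<eta>"
    using F by (subst Bochner_Integration.integral_add)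
             (auto intro!: integrable_const_bound[where B=1] simp: prob_space)
  finally have "prob (D 0) \<le> (\<integral>\<omega>. F 0 (Y 0 \<omega>) \<partial>M) + real n * \<eta>"
    using F \<eta> by (subst (asm) emeasure_eq_measure, subst (asm) ennreal_le_iff) (auto intro!: add_nonneg_nonneg integral_nonneg)
  also have "D 0 = {\<omega>\<in>space M. \<exists>k\<le>n. Y k \<omega> \<in> B k}"
    by (auto simp: D_def)
  finally show ?thesis .
qed

text \<open>
  Here \<open>\<psi>\<close> controls the exit from the finite region in which the drifts are bounded, and \<open>\<phi>\<close> is the
  function whose hitting of level $1$ after time \<open>t0\<close> is to be excluded. Before \<open>t0\<close> the drift of \<open>\<phi>\<close> is
  allowed to pay for the growth of the factor $e^{-\kappa (t_0 - t)^+}$. The hitting event is an uncountable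
  union over times, therefore its probability is bounded through a measurable superset.
\<close>

lemma markov_jump_process_hitting:
  fixes q :: "'x::countable \<Rightarrow> 'x \<Rightarrow> real" and \<phi> \<psi> :: "'x \<Rightarrow> real"
  assumes X: "markov_jump_process M X q"
    and q: "\<And>x y. y \<noteq> x \<Longrightarrow> 0 \<le> q x y" "\<And>x. finite {y. y \<noteq> x \<and> q x y \<noteq> 0}"
    and nonneg: "\<And>x. 0 \<le> \<phi> x" "\<And>x. 0 \<le> \<psi> x"
    and fin: "finite {x. \<psi> x < 1}"
    and drift_\<psi>: "\<And>x. \<psi> x < 1 \<Longrightarrow> jump_drift q \<psi> x \<le> c1"
    and drift_\<phi>: "\<And>x. \<psi> x < 1 \<Longrightarrow> \<kappa> * \<phi> x + jump_drift q \<phi> x \<le> c2"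
    and pos: "0 \<le> c1" "0 \<le> c2" "0 \<le> \<kappa>" "0 \<le> t0" "0 < T"
  obtains E where "E \<in> sets M" "{\<omega>\<in>space M. \<exists>t\<in>{t0..<T}. 1 \<le> \<phi> (X t \<omega>)} \<subseteq> E"
    "measure M E \<le> (\<integral>\<omega>. min 1 (\<psi> (X 0 \<omega>) + exp (- \<kappa> * t0) * \<phi> (X 0 \<omega>)) \<partial>M) + (c1 + c2) * T"
proof -
  interpret prob_space M using X by (simp add: markov_jump_process_def)
  have Xm: "X t \<in> measurable M (count_space UNIV)" if "t \<ge> 0" for t
    using X that by (simp add: markov_jump_process_def)
  obtain P where P: "transition_semigroup P" "has_jump_rates P q" and
    fdd: "\<forall>n (\<tau> :: nat \<Rightarrow> real) x. 0 \<le> \<tau> 0 \<and> (\<forall>k<n. \<tau> k \<le> \<tau> (Suc k)) \<longrightarrow>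
           \<P>(\<omega> in M. \<forall>k\<le>n. X (\<tau> k) \<omega> = x k) =
           \<P>(\<omega> in M. X (\<tau> 0) \<omega> = x 0) *
             (\<Prod>k<n. pmf (P (\<tau> (Suc k) - \<tau> k) (x k)) (x (Suc k)))"
    using X unfolding markov_jump_process_def by blast
  \<comment> \<open>Equal to 1 from \<open>t0\<close> on, so that the function below dominates the indicator of the hitting event.\<close>
  define a where "a t = exp (- \<kappa> * max 0 (t0 - t))" for t
  have a: "0 \<le> a t" "a t \<le> 1" for t using pos by (auto simp: a_def)
  define F where "F t x = min 1 (\<psi> x + a t * \<phi> x)" for t x
  have F: "0 \<le> F t x" "F t x \<le> 1" for t x using a nonneg by (auto simp: F_def)
  define rhs where "rhs = (\<integral>\<omega>. F 0 (X 0 \<omega>) \<partial>M) + (c1 + c2) * T"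
  define E where "E m = {\<omega>\<in>space M. \<exists>k\<le>nat \<lfloor>T * 2 ^ m\<rfloor>. t0 \<le> real k / 2 ^ m \<and> 1 \<le> \<phi> (X (real k / 2 ^ m) \<omega>)}"
    for m :: nat
  have Em: "E m \<in> sets M" for m
    unfolding E_def by (measurable; rule measurable_compose[OF Xm]) auto
  have short_step: "\<forall>\<^sub>F \<delta> in at_right 0. \<forall>t x. measure_pmf.expectation (P \<delta> x) (F (t + \<delta>)) \<le> F t x + (c1 + c2 + \<eta>) * \<delta>"
    if \<eta>: "\<eta> > 0" for \<eta>
  proof -
    define S where "S = {x. \<psi> x < 1}"
    have "\<forall>\<^sub>F \<delta> in at_right 0. \<forall>x\<in>S. \<forall>g. (\<forall>y. 0 \<le> g y \<and> g y \<le> 1) \<longrightarrow>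
            measure_pmf.expectation (P \<delta> x) g \<le> g x + \<delta> * jump_drift q g x + \<eta> * \<delta>"
      using fin unfolding S_def[symmetric]
      by (intro eventually_ball_finite ballI small_time_expectation P q \<eta>)
    moreover have "\<forall>\<^sub>F \<delta> in at_right 0. \<forall>x\<in>S. \<delta> * (\<Sum>y | y \<noteq> x \<and> q x y \<noteq> 0. q x y) < 1"
    proof (use fin in \<open>unfold S_def[symmetric]\<close>, intro eventually_ball_finite ballI)
      fix x
      have "((\<lambda>\<delta>. \<delta> * (\<Sum>y | y \<noteq> x \<and> q x y \<noteq> 0. q x y)) \<longlongrightarrow> 0 * (\<Sum>y | y \<noteq> x \<and> q x y \<noteq> 0. q x y)) (at_right 0)"
        by (intro tendsto_intros)
      then show "\<forall>\<^sub>F \<delta> in at_right 0. \<delta> * (\<Sum>y | y \<noteq> x \<and> q x y \<noteq> 0. q x y) < 1"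
        by (intro order_tendstoD) auto
    qed
    ultimately show ?thesis
      using eventually_at_right_less[of 0]
    proof eventually_elim
      case (elim \<delta>)
      show ?case
      proof (intro allI)
        fix t x
        show "measure_pmf.expectation (P \<delta> x) (F (t + \<delta>)) \<le> F t x + (c1 + c2 + \<eta>) * \<delta>"
        \<comment> \<open>Where the cap is active the one-step inequality is trivial; elsewhere the state lies in the
          finite region, in which one step size works for all states.\<close>
        proof (cases "\<psi> x + a t * \<phi> x < 1")
          case False
          have "measure_pmf.expectation (P \<delta> x) (F (t + \<delta>)) \<le> measure_pmf.expectation (P \<delta> x) (\<lambda>_. 1)"
            using F by (intro integral_mono measure_pmf.integrable_const_bound[where B=1]) auto
          also have "\<dots> = F t x" using False by (simp add: F_def)
          also have "\<dots> \<le> F t x + (c1 + c2 + \<eta>) * \<delta>" using pos \<eta> elim by simp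
          finally show ?thesis .
        next
          case True
          have "0 \<le> a t * \<phi> x" using a nonneg by simp
          then have x: "\<psi> x < 1" "x \<in> S" using True by (auto simp: S_def)
          let ?b = "a (t + \<delta>)"
          \<comment> \<open>The growth of the exponential factor in one step is paid by \<open>\<kappa> * \<phi> x\<close>.\<close>
          have decay: "?b * (1 - \<kappa> * \<delta>) \<le> a t"
          proof -
            have "?b * (1 - \<kappa> * \<delta>) \<le> ?b * exp (- (\<kappa> * \<delta>))"
              using a exp_ge_add_one_self[of "- (\<kappa> * \<delta>)"] by (intro mult_left_mono) auto
            also have "\<dots> = exp (- (\<kappa> * (max 0 (t0 - (t + \<delta>)) + \<delta>)))"
              by (simp add: a_def exp_add[symmetric] algebra_simps)
            also have "\<dots> \<le> a t"
              using pos elim(3) by (auto simp: a_def intro!: mult_left_mono)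
            finally show ?thesis .
          qed
          have "measure_pmf.expectation (P \<delta> x) (F (t + \<delta>)) \<le> F (t + \<delta>) x + \<delta> * jump_drift q (F (t + \<delta>)) x + \<eta> * \<delta>"
            using elim(1) x F by blast
          also have "F (t + \<delta>) x + \<delta> * jump_drift q (F (t + \<delta>)) x
                      \<le> (\<psi> x + ?b * \<phi> x) + \<delta> * jump_drift q (\<lambda>y. \<psi> y + ?b * \<phi> y) x"
            using elim(2,3) x q by (intro euler_step_mono) (auto simp: F_def less_imp_le)
          also have "\<dots> = \<psi> x + \<delta> * jump_drift q \<psi> x + ?b * \<phi> x + \<delta> * ?b * jump_drift q \<phi> x"
            unfolding jump_drift_add_scaled by (simp add: algebra_simps)
          also have "\<dots> \<le> \<psi> x + \<delta> * c1 + ?b * \<phi> x + \<delta> * ?b * (c2 - \<kappa> * \<phi> x)"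
            using elim(3) a drift_\<psi>[OF x(1)] drift_\<phi>[OF x(1)] by (intro add_mono mult_left_mono) auto
          also have "\<dots> = \<psi> x + (?b * (1 - \<kappa> * \<delta>)) * \<phi> x + \<delta> * c1 + ?b * (\<delta> * c2)"
            by (simp add: algebra_simps)
          also have "\<dots> \<le> \<psi> x + a t * \<phi> x + \<delta> * c1 + 1 * (\<delta> * c2)"
            using elim(3) pos a nonneg decay by (intro add_mono mult_right_mono) auto
          also have "\<psi> x + a t * \<phi> x = F t x" using True by (simp add: F_def)
          finally show ?thesis by (simp add: algebra_simps)
        qed
      qed
    qed
  qed
  have "prob (E m) \<le> rhs + \<eta> * T"
    if m: "\<forall>t x. measure_pmf.expectation (P (1 / 2 ^ m) x) (F (t + 1 / 2 ^ m)) \<le> F t x + (c1 + c2 + \<eta>) * (1 / 2 ^ m)"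
      and \<eta>: "\<eta> > 0" for m :: nat and \<eta>
  proof -
    define n where "n = nat \<lfloor>T * 2 ^ m\<rfloor>"
    have "prob (E m) = \<P>(\<omega> in M. \<exists>k\<le>n. X (real k / 2 ^ m) \<omega> \<in> {x. t0 \<le> real k / 2 ^ m \<and> 1 \<le> \<phi> x})"
      by (simp add: E_def n_def)
    also have "\<dots> \<le> (\<integral>\<omega>. F (real 0 / 2 ^ m) (X (real 0 / 2 ^ m) \<omega>) \<partial>M) + real n * ((c1 + c2 + \<eta>) * (1 / 2 ^ m))"
    proof (rule hitting_probability_le[where K = "P (1 / 2 ^ m)" and F = "\<lambda>k. F (real k / 2 ^ m)"])
      show "\<P>(\<omega> in M. \<forall>k\<le>n. X (real k / 2 ^ m) \<omega> = x k) =
         \<P>(\<omega> in M. X (real 0 / 2 ^ m) \<omega> = x 0) * (\<Prod>k<n. pmf (P (1 / 2 ^ m) (x k)) (x (Suc k)))" for n x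
        using fdd[rule_format, of "\<lambda>k. real k / 2 ^ m" n x] by (simp add: divide_right_mono diff_divide_distrib[symmetric])
      show "F (real k / 2 ^ m) x = 1" if "x \<in> {x. t0 \<le> real k / 2 ^ m \<and> 1 \<le> \<phi> x}" for k x
        using that nonneg[of x] by (auto simp: F_def a_def)
      show "measure_pmf.expectation (P (1 / 2 ^ m) x) (F (real (Suc k) / 2 ^ m))
              \<le> F (real k / 2 ^ m) x + (c1 + c2 + \<eta>) * (1 / 2 ^ m)" for k x
        using m[rule_format, of x "real k / 2 ^ m"] by (simp add: add_divide_distrib add.commute)
    qed (use F pos \<eta> in \<open>auto intro: Xm prob_space_axioms\<close>)
    also have "real n * ((c1 + c2 + \<eta>) * (1 / 2 ^ m)) = (c1 + c2 + \<eta>) * (real n / 2 ^ m)" by simp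
    also have "\<dots> \<le> (c1 + c2 + \<eta>) * T"
    proof (intro mult_left_mono)
      have "real n \<le> T * 2 ^ m" using pos by (simp add: n_def)
      then show "real n / 2 ^ m \<le> T" by (simp add: field_simps)
    qed (use pos \<eta> in auto)
    finally show ?thesis by (simp add: rhs_def algebra_simps)
  qed
  then have "\<forall>\<^sub>F m in sequentially. prob (E m) \<le> rhs + \<eta> * T" if \<eta>: "\<eta> > 0" for \<eta>
  proof -
    have "filterlim (\<lambda>m. 1 / 2 ^ m :: real) (at_right 0) sequentially"
      by (intro tendsto_imp_filterlim_at_right) (auto intro!: LIMSEQ_divide_realpow_zero)
    from eventually_compose_filterlim[OF short_step[OF \<eta>] this] show ?thesis
      by eventually_elim (use \<open>\<And>m \<eta>. _ \<Longrightarrow> \<eta> > 0 \<Longrightarrow> prob (E m) \<le> rhs + \<eta> * T\<close> \<eta> in blast)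
  qed
  moreover have "(\<lambda>m. prob (E m)) \<longlonglongrightarrow> prob (\<Union>m. E m)"
  proof (rule finite_Lim_measure_incseq)
    show "incseq E"
    proof (rule incseq_SucI, safe)
      fix m \<omega> assume "\<omega> \<in> E m"
      then obtain k where k: "\<omega> \<in> space M" "k \<le> nat \<lfloor>T * 2 ^ m\<rfloor>" "t0 \<le> real k / 2 ^ m" "1 \<le> \<phi> (X (real k / 2 ^ m) \<omega>)"
        by (auto simp: E_def)
      have eq: "real (2 * k) / 2 ^ Suc m = real k / 2 ^ m" by simp
      have le: "2 * k \<le> nat \<lfloor>T * 2 ^ Suc m\<rfloor>"
      proof -
        have "real k \<le> T * 2 ^ m" using k(2) pos(5) by (simp add: le_nat_iff le_floor_iff)
        then have "real (2 * k) \<le> T * 2 ^ Suc m" by simp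
        then show ?thesis by (simp only: le_nat_floor)
      qed
      show "\<omega> \<in> E (Suc m)" unfolding E_def
        by (intro CollectI conjI exI[of _ "2 * k"]) (simp_all only: k eq le)
    qed
  qed (use Em in auto)
  ultimately have bound: "prob (\<Union>m. E m) \<le> rhs + \<eta> * T" if "\<eta> > 0" for \<eta>
    using that tendsto_upperbound[of "\<lambda>m. prob (E m)"] by force
  have union: "prob (\<Union>m. E m) \<le> rhs"
  proof (rule field_le_epsilon)
    fix e :: real assume "0 < e"
    then show "prob (\<Union>m. E m) \<le> rhs + e" using bound[of "e / T"] pos(5) by simp
  qed
  have "{\<omega>\<in>space M. \<exists>t\<in>{t0..<T}. 1 \<le> \<phi> (X t \<omega>)} \<subseteq> (\<Union>m. E m)"
  proof safe
    fix \<omega> t assume \<omega>: "\<omega> \<in> space M" and t: "t \<in> {t0..<T}" and hit: "1 \<le> \<phi> (X t \<omega>)"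
    have "\<forall>\<^sub>F s in at_right t. X s \<omega> = X t \<omega>"
      using X \<omega> t pos(4) unfolding markov_jump_process_def cadlag_paths_def by auto
    then obtain b where b: "b > t" "\<And>s. t < s \<Longrightarrow> s < b \<Longrightarrow> X s \<omega> = X t \<omega>"
      by (auto simp: eventually_at_right_field)
    define u where "u = min b T"
    have u: "t < u" "u \<le> b" "u \<le> T" using b t by (auto simp: u_def)
    have "\<forall>\<^sub>F m in sequentially. 1 / 2 ^ m < u - t"
      using u by (intro order_tendstoD[OF LIMSEQ_divide_realpow_zero]) auto
    then obtain m :: nat where m: "1 / 2 ^ m < u - t" by (auto simp: eventually_sequentially)
    \<comment> \<open>The first point of the grid after \<open>t\<close>; the path is still constant there.\<close>
    define k where "k = nat \<lfloor>t * 2 ^ m\<rfloor> + 1"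
    have k0: "real k = of_int \<lfloor>t * 2 ^ m\<rfloor> + 1" using t pos(4) by (simp add: k_def)
    have k1: "t * 2 ^ m < real k" "real k \<le> t * 2 ^ m + 1" unfolding k0 by linarith+
    have k2: "t < real k / 2 ^ m" using k1 by (simp add: field_simps)
    have "real k / 2 ^ m \<le> t + 1 / 2 ^ m" using k1 by (simp add: field_simps)
    then have k3: "real k / 2 ^ m < u" using m by linarith
    then have "real k / 2 ^ m < T" using u by linarith
    then have "real k \<le> T * 2 ^ m" by (simp add: pos_divide_less_eq)
    then have "k \<le> nat \<lfloor>T * 2 ^ m\<rfloor>" by (simp add: le_nat_iff le_floor_iff)
    moreover have "X (real k / 2 ^ m) \<omega> = X t \<omega>" using b(2) k2 k3 u by simp
    ultimately have "\<omega> \<in> E m" using \<omega> hit k2 t unfolding E_def by force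
    then show "\<omega> \<in> (\<Union>m. E m)" by blast
  qed
  moreover have "(\<Union>m. E m) \<in> sets M" using Em by blast
  ultimately show ?thesis
    using that[of "\<Union>m. E m"] union pos by (simp add: rhs_def F_def a_def)
qed

section \<open>Shortest-queue routing on a connected graph\<close>

lemma sum_ordered_pairs_swap:
  fixes f :: "'s::finite \<Rightarrow> 's \<Rightarrow> real"
  shows "(\<Sum>i\<in>UNIV. \<Sum>j\<in>UNIV - {i}. f i j) = (\<Sum>i\<in>UNIV. \<Sum>j\<in>UNIV - {i}. f j i)"
proof -
  have *: "(\<Sum>i\<in>UNIV. \<Sum>j\<in>UNIV - {i}. g i j) = (\<Sum>i\<in>UNIV. \<Sum>j\<in>UNIV. of_bool (i \<noteq> j) * g i j)"
    for g :: "'s \<Rightarrow> 's \<Rightarrow> real"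
    by (intro sum.cong refl sum.mono_neutral_cong_left) auto
  show ?thesis unfolding * by (subst sum.swap) (intro sum.cong; auto)
qed

lemma sum_ordered_pairs:
  fixes f :: "'s::finite set \<Rightarrow> real"
  shows "(\<Sum>i\<in>UNIV. \<Sum>j\<in>UNIV - {i}. f {i, j}) = 2 * (\<Sum>e\<in>station_pairs. f e)"
proof -
  define D :: "('s \<times> 's) set" where "D = (SIGMA i:UNIV. UNIV - {i})"
  define h :: "'s \<times> 's \<Rightarrow> 's set" where "h = (\<lambda>(i, j). {i, j})"
  have img: "h ` D = station_pairs"
    by (auto simp: D_def h_def station_pairs_def)
  have "(\<Sum>i\<in>UNIV. \<Sum>j\<in>UNIV - {i}. f {i, j}) = (\<Sum>x\<in>D. f (h x))"
    unfolding D_def h_def by (subst sum.Sigma) (auto simp: split_def)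
  also have "\<dots> = (\<Sum>e\<in>station_pairs. \<Sum>x\<in>{x\<in>D. h x = e}. f (h x))"
    unfolding img[symmetric] by (rule sum.image_gen) simp
  also have "\<dots> = (\<Sum>e\<in>station_pairs. 2 * f e)"
  proof (intro sum.cong refl)
    fix e :: "'s set" assume "e \<in> station_pairs"
    then obtain a b where ab: "e = {a, b}" "a \<noteq> b" by (auto simp: station_pairs_def)
    have "{x\<in>D. h x = e} = {(a, b), (b, a)}"
      using ab by (auto simp: D_def h_def doubleton_eq_iff)
    then show "(\<Sum>x\<in>{x\<in>D. h x = e}. f (h x)) = 2 * f e"
      using ab by (simp add: h_def insert_commute)
  qed
  finally show ?thesis by (simp add: sum_distrib_left)
qed

locale swapping_network =
  fixes p :: "'s::finite set \<Rightarrow> real" and lam mu \<beta> \<gamma> :: real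
  assumes stations: "CARD('s) \<ge> 2"
    and lam: "lam > 0" and mu: "mu > 0" and \<gamma>\<beta>: "\<gamma> \<le> \<beta>"
    and p_nonneg: "\<And>e. e \<in> station_pairs \<Longrightarrow> p e \<ge> 0"
    and p_sum: "(\<Sum>e\<in>station_pairs. p e) = 1"
    and connected: "pair_graph_connected p"
begin

abbreviation w :: "'s \<Rightarrow> real" where "w \<equiv> station_prob p"

lemma pair_nonneg: "i \<noteq> j \<Longrightarrow> 0 \<le> p {i, j}"
  using p_nonneg by (auto simp: station_pairs_def)

lemma sum_w: "(\<Sum>i\<in>UNIV. w i) = 1"
  by (simp add: station_prob_def sum_divide_distrib[symmetric] sum_ordered_pairs p_sum)

lemma w_pos: "0 < w i"
proof -
  obtain j where j: "j \<noteq> i"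
  proof (cases "UNIV = {i}")
    case True
    then have "CARD('s) = card {i}" by (rule arg_cong)
    then show ?thesis using stations by simp
  next
    case False
    then show ?thesis using that by blast
  qed
  define R where "R = {(a, b). a \<noteq> b \<and> p {a, b} > 0}"
  have "(i, j) \<in> R\<^sup>*"
    using connected by (simp add: pair_graph_connected_def R_def)
  then obtain b where "(i, b) \<in> R"
    using j by (cases rule: converse_rtranclE) auto
  then have b: "b \<noteq> i" "0 < p {i, b}" by (auto simp: R_def)
  have "p {i, b} \<le> (\<Sum>j\<in>UNIV - {i}. p {i, j})"
    using b pair_nonneg by (intro member_le_sum) auto
  then show ?thesis using b by (simp add: station_prob_def)
qed

lemma w_ne: "w i \<noteq> 0" using w_pos[of i] by simp

lemma w_le: "w i \<le> 1"
  using member_le_sum[of i UNIV w] sum_w w_pos by (simp add: less_imp_le)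

definition pair_disparity :: "('s \<Rightarrow> real) \<Rightarrow> real" where
  "pair_disparity f = (\<Sum>i\<in>UNIV. \<Sum>j\<in>UNIV - {i}. p {i, j} * \<bar>f i - f j\<bar>)"

lemma pair_disparity_nonneg: "0 \<le> pair_disparity f"
  unfolding pair_disparity_def using pair_nonneg by (intro sum_nonneg mult_nonneg_nonneg) auto

text \<open>
  The difference between two stations is a sum of differences along a path of edges, each of which
  occurs in the disparity with a positive weight.
\<close>

lemma pair_disparity_connected:
  obtains C where "0 < C" "\<And>f i j. \<bar>f i - f j\<bar> \<le> C * pair_disparity f"
proof -
  have "\<exists>C\<ge>0. \<forall>f. \<bar>f i - f j\<bar> \<le> C * pair_disparity f" for i j
  proof -
    have "(i, j) \<in> {(a, b). a \<noteq> b \<and> p {a, b} > 0}\<^sup>*"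
      using connected by (simp add: pair_graph_connected_def)
    then show ?thesis
    proof (induction rule: rtrancl_induct)
      case base
      show ?case by (intro exI[of _ 0]) auto
    next
      case (step y z)
      from step(3) obtain C where C: "0 \<le> C" "\<And>f. \<bar>f i - f y\<bar> \<le> C * pair_disparity f" by auto
      have yz: "y \<noteq> z" "0 < p {y, z}" using step(2) by auto
      have "\<bar>f i - f z\<bar> \<le> (C + 1 / p {y, z}) * pair_disparity f" for f
      proof -
        have "p {y, z} * \<bar>f y - f z\<bar> \<le> (\<Sum>j\<in>UNIV - {y}. p {y, j} * \<bar>f y - f j\<bar>)"
          using yz pair_nonneg by (intro member_le_sum mult_nonneg_nonneg) auto
        also have "\<dots> \<le> pair_disparity f"
          unfolding pair_disparity_def
          using pair_nonneg by (intro member_le_sum[of y UNIV] sum_nonneg mult_nonneg_nonneg) auto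
        finally have "\<bar>f y - f z\<bar> \<le> 1 / p {y, z} * pair_disparity f"
          using yz by (simp add: field_simps)
        then show ?thesis using C(2)[of f] by (simp add: distrib_right)
      qed
      then show ?case using C yz by (intro exI[of _ "C + 1 / p {y, z}"]) auto
    qed
  qed
  then obtain C where C: "\<And>i j. 0 \<le> C i j" "\<And>i j f. \<bar>f i - f j\<bar> \<le> C i j * pair_disparity f"
    by metis
  define C' where "C' = 1 + (\<Sum>i\<in>UNIV. \<Sum>j\<in>UNIV. C i j)"
  have "C i j \<le> C'" for i j
  proof -
    have "C i j \<le> (\<Sum>j\<in>UNIV. C i j)" using C by (intro member_le_sum) auto
    also have "\<dots> \<le> (\<Sum>i\<in>UNIV. \<Sum>j\<in>UNIV. C i j)"
      using C by (intro member_le_sum[of i UNIV "\<lambda>i. \<Sum>j\<in>UNIV. C i j"] sum_nonneg) auto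
    finally show ?thesis by (simp add: C'_def)
  qed
  then have "\<bar>f i - f j\<bar> \<le> C' * pair_disparity f" for f i j
    using C(2)[of f i j] pair_disparity_nonneg by (meson mult_right_mono order_trans)
  moreover have "0 < C'"
    using C by (auto simp: C'_def intro!: add_pos_nonneg sum_nonneg)
  ultimately show ?thesis using that by blast
qed

text \<open>
  For \<open>f\<close> nondecreasing along \<open>q\<close>, the pair $\{i,j\}$ contributes the smaller of the two values of \<open>f\<close>,
  which is $(f_i + f_j - |f_i - f_j|)/2$, and the weight of a station is half the sum of the
  probabilities of its pairs.
\<close>

lemma sum_shortest_choice:
  assumes less: "\<And>i j. q i < q j \<Longrightarrow> f i \<le> f j" and eq: "\<And>i j. q i = q j \<Longrightarrow> f i = f j"
  shows "(\<Sum>i\<in>UNIV. f i * (\<Sum>j\<in>UNIV - {i}. p {i, j} *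
             (of_bool (q i < q j) + 1/2 * of_bool (q i = (q j :: real)))))
           = (\<Sum>i\<in>UNIV. w i * f i) - pair_disparity f / 4"
proof -
  define s where "s i j = (of_bool (q i < q j) + 1/2 * of_bool (q i = q j) :: real)" for i j
  have min: "f i * s i j + f j * s j i = (f i + f j - \<bar>f i - f j\<bar>) / 2" for i j
    using less[of i j] less[of j i] eq[of i j] by (auto simp: s_def abs_if)
  define A where "A = (\<Sum>i\<in>UNIV. \<Sum>j\<in>UNIV - {i}. p {i, j} * (f i * s i j))"
  have wf: "(\<Sum>i\<in>UNIV. \<Sum>j\<in>UNIV - {i}. p {i, j} * f i) = 2 * (\<Sum>i\<in>UNIV. w i * f i)"
    by (simp add: station_prob_def sum_distrib_left sum_distrib_right)
  have wf': "(\<Sum>i\<in>UNIV. \<Sum>j\<in>UNIV - {i}. p {i, j} * f j) = 2 * (\<Sum>i\<in>UNIV. w i * f i)"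
    unfolding wf[symmetric] by (subst sum_ordered_pairs_swap) (simp add: insert_commute)
  have "A = (\<Sum>i\<in>UNIV. \<Sum>j\<in>UNIV - {i}. p {i, j} * (f j * s j i))"
    unfolding A_def by (subst sum_ordered_pairs_swap) (simp add: insert_commute)
  then have "2 * A = (\<Sum>i\<in>UNIV. \<Sum>j\<in>UNIV - {i}. p {i, j} * (f i * s i j + f j * s j i))"
    by (simp add: A_def sum.distrib distrib_left)
  also have "\<dots> = ((\<Sum>i\<in>UNIV. \<Sum>j\<in>UNIV - {i}. p {i, j} * f i) + (\<Sum>i\<in>UNIV. \<Sum>j\<in>UNIV - {i}. p {i, j} * f j)
                   - pair_disparity f) / 2"
    unfolding min pair_disparity_def
    by (simp add: sum.distrib sum_subtractf sum_divide_distrib[symmetric] algebra_simps)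
  finally have "A = (\<Sum>i\<in>UNIV. w i * f i) - pair_disparity f / 4"
    unfolding wf wf' by simp
  also have "A = (\<Sum>i\<in>UNIV. f i * (\<Sum>j\<in>UNIV - {i}. p {i, j} * s i j))"
    by (simp add: A_def sum_distrib_left mult.left_commute)
  finally show ?thesis by (simp add: s_def)
qed

section \<open>Jumps of the queues in diffusion scaling\<close>

abbreviation \<rho> :: "nat \<Rightarrow> real" where "\<rho> r \<equiv> lam * real r / mu"

abbreviation q :: "nat \<Rightarrow> nat ^ 's \<Rightarrow> 's \<Rightarrow> real" where
  "q r x i \<equiv> diffusion_scaled p lam mu r x $ i"

abbreviation rates :: "nat \<Rightarrow> nat ^ 's \<Rightarrow> nat ^ 's \<Rightarrow> real" where
  "rates \<equiv> queue_rates p lam mu \<beta> \<gamma>"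

abbreviation arr :: "nat \<Rightarrow> nat ^ 's \<Rightarrow> 's \<Rightarrow> real" where
  "arr \<equiv> arrival_rate p lam mu \<beta>"

abbreviation chg :: "nat \<Rightarrow> nat ^ 's \<Rightarrow> 's \<Rightarrow> real" where
  "chg \<equiv> charging_rate p lam mu \<gamma>"

lemma \<rho>_pos: "0 < r \<Longrightarrow> 0 < \<rho> r"
  using lam mu by simp

lemma q_eq: "q r x i = (real (x $ i) - w i * \<rho> r) / (w i * sqrt (\<rho> r))"
  by (simp add: diffusion_scaled_def)

lemma arr_nonneg: "0 \<le> arr r x i"
  unfolding arrival_rate_def using lam pair_nonneg
  by (intro mult_nonneg_nonneg sum_nonneg) auto

lemma chg_nonneg: "0 \<le> chg r x i"
  unfolding charging_rate_def using mu by simp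

lemma rates_nonneg: "0 \<le> rates r x y"
  unfolding queue_rates_def using arr_nonneg chg_nonneg
  by (intro sum_nonneg add_nonneg_nonneg mult_nonneg_nonneg) auto

lemma rates_support:
  "{y. y \<noteq> x \<and> rates r x y \<noteq> 0} \<subseteq> range (\<lambda>i. x + axis i 1) \<union> range (\<lambda>i. x - axis i 1)"
proof
  fix y assume "y \<in> {y. y \<noteq> x \<and> rates r x y \<noteq> 0}"
  then obtain i where "y = x + axis i 1 \<or> x = y + axis i 1"
    unfolding queue_rates_def
    by (elim CollectE conjE sum.not_neutral_contains_not_neutral) (auto simp: of_bool_def split: if_splits)
  moreover have "y = y + axis i 1 - axis i 1" by (simp add: vec_eq_iff)
  ultimately show "y \<in> range (\<lambda>i. x + axis i 1) \<union> range (\<lambda>i. x - axis i 1)"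
    by blast
qed

lemma rates_finite: "finite {y. y \<noteq> x \<and> rates r x y \<noteq> 0}"
  by (rule finite_subset[OF rates_support]) auto

text \<open>
  At an empty station the truncated difference of vectors equals the state itself, but there the charging
  rate vanishes.
\<close>

lemma jump_drift_rates:
  "jump_drift (rates r) f x =
     (\<Sum>i\<in>UNIV. arr r x i * (f (x + axis i 1) - f x) + chg r x i * (f (x - axis i 1) - f x))"
proof -
  define U where "U = range (\<lambda>i. x + axis i 1) \<union> range (\<lambda>i. x - axis i (1::nat))"
  have U: "finite U" by (auto simp: U_def)
  have "jump_drift (rates r) f x = (\<Sum>y\<in>U. rates r x y * (f y - f x))"
    unfolding jump_drift_def using U rates_support[of x r]
    by (intro sum.mono_neutral_left) (auto simp: U_def)
  also have "\<dots> = (\<Sum>i\<in>UNIV. \<Sum>y\<in>U. of_bool (y = x + axis i 1) * arr r x i * (f y - f x)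
                              + of_bool (x = y + axis i 1) * chg r x i * (f y - f x))"
    unfolding queue_rates_def sum_distrib_right by (subst sum.swap) (simp add: distrib_right)
  also have "\<dots> = (\<Sum>i\<in>UNIV. arr r x i * (f (x + axis i 1) - f x) + chg r x i * (f (x - axis i 1) - f x))"
  proof (intro sum.cong refl)
    fix i
    have "(\<Sum>y\<in>U. of_bool (y = x + axis i 1) * arr r x i * (f y - f x))
            = (\<Sum>y\<in>{x + axis i 1}. arr r x i * (f y - f x))"
      using U by (intro sum.mono_neutral_cong_right) (auto simp: U_def)
    moreover have "(\<Sum>y\<in>U. of_bool (x = y + axis i 1) * chg r x i * (f y - f x))
                     = chg r x i * (f (x - axis i 1) - f x)"
    proof (cases "x $ i = 0")
      case True
      then have "chg r x i = 0" using mu by (simp add: charging_rate_def)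
      then show ?thesis by simp
    next
      case False
      then have "x = y + axis i 1 \<longleftrightarrow> y = x - axis i 1" for y
        by (auto simp: vec_eq_iff axis_def)
      then have "(\<Sum>y\<in>U. of_bool (x = y + axis i 1) * chg r x i * (f y - f x))
                   = (\<Sum>y\<in>{x - axis i 1}. chg r x i * (f y - f x))"
        using U by (intro sum.mono_neutral_cong_right) (auto simp: U_def)
      then show ?thesis by simp
    qed
    ultimately show "(\<Sum>y\<in>U. of_bool (y = x + axis i 1) * arr r x i * (f y - f x)
                              + of_bool (x = y + axis i 1) * chg r x i * (f y - f x))
        = arr r x i * (f (x + axis i 1) - f x) + chg r x i * (f (x - axis i 1) - f x)"
      by (simp add: sum.distrib)
  qed
  finally show ?thesis .
qed

lemma jump_drift_rates_le:
  assumes up: "\<And>i. f (x + axis i 1) - f x \<le> u i"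
    and down: "\<And>i. x $ i > 0 \<Longrightarrow> f (x - axis i 1) - f x \<le> d i"
  shows "jump_drift (rates r) f x \<le> (\<Sum>i\<in>UNIV. arr r x i * u i + chg r x i * d i)"
  unfolding jump_drift_rates
proof (intro sum_mono add_mono)
  fix i
  show "arr r x i * (f (x + axis i 1) - f x) \<le> arr r x i * u i"
    by (intro mult_left_mono up arr_nonneg)
  show "chg r x i * (f (x - axis i 1) - f x) \<le> chg r x i * d i"
  proof (cases "x $ i = 0")
    case True
    then have "chg r x i = 0" using mu by (simp add: charging_rate_def)
    then show ?thesis by simp
  next
    case False
    then show ?thesis using down[of i] chg_nonneg by (intro mult_left_mono) auto
  qed
qed

lemma q_up: "q r (x + axis i 1) = (q r x)(i := q r x i + 1 / (w i * sqrt (\<rho> r)))"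
  by (auto simp: fun_eq_iff q_eq axis_def field_simps add_divide_distrib diff_divide_distrib)

lemma q_down:
  "x $ i > 0 \<Longrightarrow> q r (x - axis i 1) = (q r x)(i := q r x i - 1 / (w i * sqrt (\<rho> r)))"
  by (auto simp: fun_eq_iff q_eq axis_def of_nat_diff add_divide_distrib diff_divide_distrib)

section \<open>Spread and excess of the scaled queues\<close>

definition mean :: "('s \<Rightarrow> real) \<Rightarrow> real" where
  "mean f = (\<Sum>i\<in>UNIV. w i * f i)"

definition spread :: "('s \<Rightarrow> real) \<Rightarrow> real" where
  "spread f = (\<Sum>i\<in>UNIV. w i * (f i - mean f)\<^sup>2)"

definition excess :: "('s \<Rightarrow> real) \<Rightarrow> real" where
  "excess f = (\<Sum>i\<in>UNIV. w i * (max 0 (f i - \<gamma>))\<^sup>2)"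

lemma sum_weighted_upd:
  "(\<Sum>j\<in>UNIV. w j * g ((f(i := y)) j)) = (\<Sum>j\<in>UNIV. w j * g (f j)) + w i * (g y - g (f i))"
proof -
  have "(\<Sum>j\<in>UNIV. w j * g ((f(i := y)) j)) = w i * g y + (\<Sum>j\<in>UNIV - {i}. w j * g (f j))"
    by (subst sum.remove[of _ i]) (auto intro!: sum.cong)
  also have "(\<Sum>j\<in>UNIV - {i}. w j * g (f j)) = (\<Sum>j\<in>UNIV. w j * g (f j)) - w i * g (f i)"
    by (subst sum.remove[of UNIV i]) auto
  finally show ?thesis by (simp add: algebra_simps)
qed

lemma sum_w_centred: "(\<Sum>i\<in>UNIV. w i * (f i - mean f)) = 0"
  by (simp add: right_diff_distrib sum_subtractf mean_def sum_distrib_right[symmetric] sum_w)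

lemma spread_eq: "spread f = (\<Sum>i\<in>UNIV. w i * (f i)\<^sup>2) - (mean f)\<^sup>2"
proof -
  have "spread f = (\<Sum>i\<in>UNIV. w i * (f i)\<^sup>2 - 2 * mean f * (w i * f i) + (mean f)\<^sup>2 * w i)"
    unfolding spread_def by (intro sum.cong) (auto simp: power2_eq_square algebra_simps)
  also have "\<dots> = (\<Sum>i\<in>UNIV. w i * (f i)\<^sup>2) - 2 * mean f * mean f + (mean f)\<^sup>2"
    by (simp add: sum.distrib sum_subtractf sum_distrib_left[symmetric] sum_w mean_def[symmetric])
  finally show ?thesis by (simp add: power2_eq_square)
qed

lemma spread_nonneg: "0 \<le> spread f" and excess_nonneg: "0 \<le> excess f"
  unfolding spread_def excess_def using w_pos by (auto intro!: sum_nonneg simp: less_imp_le)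

lemma mean_sq_le: "(mean f)\<^sup>2 \<le> (\<Sum>i\<in>UNIV. w i * (f i)\<^sup>2)"
  using spread_nonneg[of f] by (simp add: spread_eq)

text \<open>
  The increment is written in terms of $w_i d$ since a jump at station $i$ has $d = \pm 1/(w_i \sqrt{\rho})$,
  so that $w_i d$ is the same for all stations.
\<close>

lemma spread_upd:
  "spread (f(i := f i + d)) - spread f = 2 * (w i * d) * (f i - mean f) + (1 / w i - 1) * (w i * d)\<^sup>2"
proof -
  have m: "mean (f(i := f i + d)) = mean f + w i * d"
    using sum_weighted_upd[of "\<lambda>x. x" f i "f i + d"] by (simp add: mean_def)
  have "w i * ((f i + d)\<^sup>2 - (f i)\<^sup>2) - ((mean f + w i * d)\<^sup>2 - (mean f)\<^sup>2)
          = 2 * (w i * d) * (f i - mean f) + (1 / w i - 1) * (w i * d)\<^sup>2"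
    using w_ne[of i] by (simp add: power2_eq_square field_simps)
  then show ?thesis
    unfolding spread_eq m using sum_weighted_upd[of "\<lambda>x. x\<^sup>2" f i "f i + d"] by simp
qed

text \<open>
  The derivative $2 y^+$ of the squared positive part is Lipschitz with constant $2$, so the
  second-order Taylor estimate holds across the kink. A function that is merely linear above \<open>\<gamma>\<close>
  could have a drift of order $\sqrt r$ there.
\<close>

lemma excess_upd:
  "excess (f(i := f i + d)) - excess f \<le> 2 * (w i * d) * max 0 (f i - \<gamma>) + 1 / w i * (w i * d)\<^sup>2"
proof -
  have "(max 0 (y + d))\<^sup>2 - (max 0 y)\<^sup>2 \<le> 2 * d * max 0 y + d\<^sup>2" for y :: real
  proof (cases "0 \<le> y + d")
    case True
    show ?thesis
    proof (cases "0 \<le> y")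
      case True
      then show ?thesis using \<open>0 \<le> y + d\<close> by (simp add: power2_eq_square algebra_simps)
    next
      case False
      then have "(y + d)\<^sup>2 \<le> d\<^sup>2" using True by (intro power_mono) auto
      then show ?thesis using False True by simp
    qed
  next
    case False
    have "0 \<le> (max 0 y + d)\<^sup>2" by simp
    then show ?thesis using False by (simp add: power2_eq_square algebra_simps)
  qed
  from this[of "f i - \<gamma>"]
  have "w i * ((max 0 (f i + d - \<gamma>))\<^sup>2 - (max 0 (f i - \<gamma>))\<^sup>2) \<le> w i * (2 * d * max 0 (f i - \<gamma>) + d\<^sup>2)"
    using w_pos[of i] by (intro mult_left_mono) (auto simp: algebra_simps)
  also have "\<dots> = 2 * (w i * d) * max 0 (f i - \<gamma>) + 1 / w i * (w i * d)\<^sup>2"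
    using w_ne[of i] by (simp add: power2_eq_square field_simps)
  finally show ?thesis
    unfolding excess_def using sum_weighted_upd[of "\<lambda>x. (max 0 (x - \<gamma>))\<^sup>2" f i "f i + d"] by simp
qed

lemma spread_le_of_gaps:
  assumes "\<And>i j. \<bar>f i - f j\<bar> \<le> d" shows "spread f \<le> d\<^sup>2"
proof -
  have d: "0 \<le> d" using assms[of undefined undefined] by simp
  have "(f i - mean f)\<^sup>2 \<le> d\<^sup>2" for i
  proof -
    have "f i - mean f = (\<Sum>j\<in>UNIV. w j * (f i - f j))"
      by (simp add: right_diff_distrib sum_subtractf mean_def sum_distrib_right[symmetric] sum_w)
    then have "\<bar>f i - mean f\<bar> \<le> (\<Sum>j\<in>UNIV. w j * d)"
      using w_pos assms by (auto intro!: order_trans[OF sum_abs] sum_mono mult_mono simp: abs_mult less_imp_le)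
    also have "\<dots> = d" by (simp add: sum_distrib_right[symmetric] sum_w)
    finally show ?thesis using d by (metis abs_le_square_iff abs_of_nonneg)
  qed
  then have "spread f \<le> (\<Sum>i\<in>UNIV. w i * d\<^sup>2)"
    unfolding spread_def using w_pos by (intro sum_mono mult_left_mono) (auto simp: less_imp_le)
  then show ?thesis by (simp add: sum_distrib_right[symmetric] sum_w)
qed

lemma spread_le_disparity:
  obtains C where "0 < C" "\<And>f. sqrt (spread f) \<le> C * pair_disparity f"
proof -
  obtain C where C: "0 < C" "\<And>f i j. \<bar>f i - f j\<bar> \<le> C * pair_disparity f"
    using pair_disparity_connected by blast
  have "sqrt (spread f) \<le> C * pair_disparity f" for f
  proof -
    let ?D = "C * pair_disparity f"
    have D: "0 \<le> ?D" using C pair_disparity_nonneg by simp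
    show ?thesis using spread_le_of_gaps[OF C(2)] D by (rule real_le_lsqrt[rotated])
  qed
  with C(1) show ?thesis using that by blast
qed

lemma sq_diff_le_spread:
  obtains c where "0 < c" "\<And>f i j. c * (f i - f j)\<^sup>2 \<le> spread f"
proof -
  \<comment> \<open>The factor 4 comes from $(x - y)^2 \le 2 x^2 + 2 y^2$ applied to the two deviations from the mean.\<close>
  define c where "c = Min (range w) / 4"
  have m: "0 < Min (range w)" by (subst Min_gr_iff) (auto simp: w_pos)
  have "c * (f i - f j)\<^sup>2 \<le> spread f" for f i j
  proof -
    have *: "Min (range w) * (f k - mean f)\<^sup>2 \<le> spread f" for k
    proof -
      have "Min (range w) * (f k - mean f)\<^sup>2 \<le> w k * (f k - mean f)\<^sup>2" by (intro mult_right_mono) auto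
      also have "\<dots> \<le> spread f"
        unfolding spread_def using w_pos
        by (intro member_le_sum[of k UNIV "\<lambda>i. w i * (f i - mean f)\<^sup>2"]) (auto simp: less_imp_le)
      finally show ?thesis .
    qed
    have "(f i - f j)\<^sup>2 \<le> 2 * (f i - mean f)\<^sup>2 + 2 * (f j - mean f)\<^sup>2"
      using zero_le_power2[of "(f i - mean f) + (f j - mean f)"] by (simp add: power2_eq_square algebra_simps)
    moreover have "0 \<le> c" using m by (simp only: c_def)
    ultimately have "c * (f i - f j)\<^sup>2 \<le> c * (2 * (f i - mean f)\<^sup>2 + 2 * (f j - mean f)\<^sup>2)"
      by (rule mult_left_mono)
    then have "c * (f i - f j)\<^sup>2 \<le> 2 * (c * (f i - mean f)\<^sup>2) + 2 * (c * (f j - mean f)\<^sup>2)"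
      by (simp add: algebra_simps)
    moreover have **: "4 * (c * (f k - mean f)\<^sup>2) \<le> spread f" for k
      using *[of k] by (simp add: c_def)
    ultimately show ?thesis using **[of i] **[of j] by linarith
  qed
  then show ?thesis using that[of c] m by (simp add: c_def)
qed

section \<open>Arrival and charging rates\<close>

definition demand_rate :: "nat \<Rightarrow> nat ^ 's \<Rightarrow> real" where
  "demand_rate r x = lam * max 0 (non_waiting_EVs p lam mu \<beta> r x)"

lemma demand_rate_bounds: "0 \<le> demand_rate r x" "demand_rate r x \<le> lam * real r"
proof -
  have "non_waiting_EVs p lam mu \<beta> r x \<le> real r"
    by (simp add: non_waiting_EVs_def sum_nonneg)
  then show "0 \<le> demand_rate r x" "demand_rate r x \<le> lam * real r"
    using lam by (auto simp: demand_rate_def)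
qed

lemma content_eq: "0 < r \<Longrightarrow> real (x $ i) = w i * (\<rho> r + sqrt (\<rho> r) * q r x i)"
proof -
  assume "0 < r"
  then have "sqrt (\<rho> r) \<noteq> 0" using \<rho>_pos[of r] lam mu by simp
  moreover have "b \<noteq> 0 \<Longrightarrow> s \<noteq> 0 \<Longrightarrow> b * (a + s * ((y - b * a) / (b * s))) = y" for a b s y :: real
    by (simp add: field_simps)
  ultimately show ?thesis unfolding q_eq using w_ne by metis
qed

lemma arr_eq:
  assumes "0 < r"
  shows "arr r x i = demand_rate r x * (\<Sum>j\<in>UNIV - {i}. p {i, j} *
           (of_bool (q r x i < q r x j) + 1/2 * of_bool (q r x i = q r x j)))"
proof -
  have "real (x $ j) / w j = \<rho> r + sqrt (\<rho> r) * q r x j" for j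
    using w_ne[of j] by (simp add: content_eq[OF assms])
  moreover have "0 < sqrt (\<rho> r)" using \<rho>_pos[OF assms] by simp
  then have "\<rho> r + sqrt (\<rho> r) * y < \<rho> r + sqrt (\<rho> r) * z \<longleftrightarrow> y < z"
    "\<rho> r + sqrt (\<rho> r) * y = \<rho> r + sqrt (\<rho> r) * z \<longleftrightarrow> y = z" for y z
    by (auto simp only: add_less_cancel_left mult_less_cancel_left_pos add_left_cancel mult_cancel_left)
  ultimately show ?thesis
    by (simp only: arrival_rate_def demand_rate_def)
qed

lemma sum_arr:
  assumes r: "0 < r" and "\<And>i j. q r x i < q r x j \<Longrightarrow> f i \<le> f j" "\<And>i j. q r x i = q r x j \<Longrightarrow> f i = f j"
  shows "(\<Sum>i\<in>UNIV. arr r x i * f i) = demand_rate r x * ((\<Sum>i\<in>UNIV. w i * f i) - pair_disparity f / 4)"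
proof -
  have "(\<Sum>i\<in>UNIV. arr r x i * f i) = demand_rate r x * (\<Sum>i\<in>UNIV. f i * (\<Sum>j\<in>UNIV - {i}. p {i, j} *
           (of_bool (q r x i < q r x j) + 1/2 * of_bool (q r x i = q r x j))))"
    by (subst sum_distrib_left, intro sum.cong refl) (simp only: arr_eq[OF r] mult_ac)
  then show ?thesis using sum_shortest_choice[of "q r x" f, OF assms(2,3)] by simp
qed

lemma arr_le:
  assumes r: "0 < r" shows "arr r x i \<le> 2 * lam * real r * w i"
proof -
  have "arr r x i \<le> lam * real r * (\<Sum>j\<in>UNIV - {i}. p {i, j} * 1)"
    unfolding arr_eq[OF r] using pair_nonneg lam demand_rate_bounds[of r x]
    by (intro mult_mono sum_mono mult_left_mono sum_nonneg mult_nonneg_nonneg) auto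
  then show ?thesis by (simp add: station_prob_def)
qed

definition service :: "nat \<Rightarrow> real \<Rightarrow> real" where
  "service r y = mu * max 0 (min (\<rho> r + sqrt (\<rho> r) * y) (\<rho> r + sqrt (\<rho> r) * \<gamma>))"

lemma chg_eq:
  assumes r: "0 < r" shows "chg r x i = w i * service r (q r x i)"
proof -
  have "min (w i * a) (w i * b) = w i * min a b" "max 0 (w i * a) = w i * max 0 a" for a b
    using w_pos[of i] by (auto simp: min_def max_def zero_le_mult_iff)
  then show ?thesis
    unfolding charging_rate_def charging_points_def service_def content_eq[OF r]
    by (simp add: mult.commute[of \<gamma>])
qed

lemma service_mono: "y \<le> z \<Longrightarrow> service r y \<le> service r z"
proof -
  assume "y \<le> z"
  then have "sqrt (\<rho> r) * y \<le> sqrt (\<rho> r) * z"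
    using lam mu by (intro mult_left_mono) auto
  then show ?thesis unfolding service_def using mu by (intro mult_left_mono) auto
qed

text \<open>
  Relative to the weight of the station, charging is at least as fast where the queue is longer. The sum does not
  change if the service at the mean is subtracted from each service, and then every term is nonnegative.
\<close>

lemma sum_chg_centred_nonneg:
  assumes r: "0 < r"
  shows "0 \<le> (\<Sum>i\<in>UNIV. chg r x i * (q r x i - mean (q r x)))"
proof -
  let ?m = "mean (q r x)"
  have "0 \<le> (\<Sum>i\<in>UNIV. w i * ((service r (q r x i) - service r ?m) * (q r x i - ?m)))"
  proof (intro sum_nonneg, rule mult_nonneg_nonneg)
    fix i
    show "0 \<le> (service r (q r x i) - service r ?m) * (q r x i - ?m)"
      using service_mono[of ?m "q r x i" r] service_mono[of "q r x i" ?m r]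
      by (cases "?m \<le> q r x i") (auto simp: zero_le_mult_iff)
  qed (use w_pos in \<open>simp add: less_imp_le\<close>)
  also have "\<dots> = (\<Sum>i\<in>UNIV. chg r x i * (q r x i - ?m)) - service r ?m * (\<Sum>i\<in>UNIV. w i * (q r x i - ?m))"
    by (simp add: chg_eq[OF r] sum_distrib_left sum_subtractf[symmetric] algebra_simps)
  finally show ?thesis by (simp add: sum_w_centred)
qed

text \<open>
  Bounds the rate of all jumps at a station, per EV and per unit of weight of the station.
\<close>

definition total_rate :: real where
  "total_rate = 3 * lam + mu * sqrt (lam / mu) * \<bar>\<gamma>\<bar>"

lemma total_rate_pos: "0 < total_rate"
  using lam mu by (auto simp: total_rate_def intro!: add_pos_nonneg)

lemma rates_le:
  assumes r: "0 < r" shows "arr r x i + chg r x i \<le> total_rate * real r * w i"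
proof -
  have "sqrt (real r) \<le> real r" using r by (intro real_le_lsqrt) (auto simp: power2_eq_square)
  then have s: "sqrt (\<rho> r) \<le> sqrt (lam / mu) * real r"
    using lam mu by (simp add: real_sqrt_mult real_sqrt_divide mult_left_mono divide_right_mono)
  have "service r (q r x i) \<le> mu * (\<rho> r + sqrt (\<rho> r) * \<bar>\<gamma>\<bar>)"
    unfolding service_def using mu lam
    by (intro mult_left_mono max.boundedI min.coboundedI2 add_left_mono mult_left_mono) auto
  also have "\<dots> \<le> mu * (\<rho> r + sqrt (lam / mu) * real r * \<bar>\<gamma>\<bar>)"
    using mu s by (intro mult_left_mono add_left_mono mult_right_mono) auto
  finally have "w i * service r (q r x i) \<le> w i * (mu * (\<rho> r + sqrt (lam / mu) * real r * \<bar>\<gamma>\<bar>))"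
    using w_pos[of i] by (intro mult_left_mono) auto
  then show ?thesis using arr_le[OF r, of x i] mu
    by (simp add: chg_eq[OF r] total_rate_def algebra_simps)
qed

section \<open>Drift of the spread and of the excess\<close>

abbreviation V :: "nat \<Rightarrow> nat ^ 's \<Rightarrow> real" where "V r x \<equiv> spread (q r x)"
abbreviation G :: "nat \<Rightarrow> nat ^ 's \<Rightarrow> real" where "G r x \<equiv> excess (q r x)"

lemma spread_jump:
  assumes r: "0 < r"
  shows "V r (x + axis i 1) - V r x = 2 / sqrt (\<rho> r) * (q r x i - mean (q r x)) + (1 / w i - 1) / \<rho> r"
    and "0 < x $ i \<Longrightarrow> V r (x - axis i 1) - V r x
           = - (2 / sqrt (\<rho> r) * (q r x i - mean (q r x))) + (1 / w i - 1) / \<rho> r"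
proof -
  define s where "s = sqrt (\<rho> r)"
  have s: "0 < s" "\<rho> r = s\<^sup>2" using \<rho>_pos[OF r] by (auto simp: s_def)
  have wd: "w i * (1 / (w i * s)) = 1 / s" "w i * (- (1 / (w i * s))) = - (1 / s)"
    using w_ne[of i] by auto
  show "V r (x + axis i 1) - V r x = 2 / sqrt (\<rho> r) * (q r x i - mean (q r x)) + (1 / w i - 1) / \<rho> r"
    unfolding q_up s_def[symmetric] spread_upd wd s(2) using s(1) w_ne[of i] by (simp add: power_divide fun_upd_def)
  assume x: "0 < x $ i"
  show "V r (x - axis i 1) - V r x = - (2 / sqrt (\<rho> r) * (q r x i - mean (q r x))) + (1 / w i - 1) / \<rho> r"
    unfolding q_down[OF x] s_def[symmetric] diff_conv_add_uminus[of "q r x i" "1 / _"] spread_upd wd s(2)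
    using s(1) w_ne[of i] by (simp add: power_divide)
qed

lemma excess_jump:
  assumes r: "0 < r"
  shows "G r (x + axis i 1) - G r x \<le> 2 / sqrt (\<rho> r) * max 0 (q r x i - \<gamma>) + 1 / w i / \<rho> r"
    and "0 < x $ i \<Longrightarrow> G r (x - axis i 1) - G r x
           \<le> - (2 / sqrt (\<rho> r) * max 0 (q r x i - \<gamma>)) + 1 / w i / \<rho> r"
proof -
  define s where "s = sqrt (\<rho> r)"
  have s: "0 < s" "\<rho> r = s\<^sup>2" using \<rho>_pos[OF r] by (auto simp: s_def)
  have wd: "w i * (1 / (w i * s)) = 1 / s" "w i * (- (1 / (w i * s))) = - (1 / s)"
    using w_ne[of i] by auto
  show "G r (x + axis i 1) - G r x \<le> 2 / sqrt (\<rho> r) * max 0 (q r x i - \<gamma>) + 1 / w i / \<rho> r"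
    using excess_upd[of "q r x" i "1 / (w i * s)"]
    unfolding q_up s_def[symmetric] wd s(2) using s(1) w_ne[of i] by (simp add: power_divide fun_upd_def)
  assume x: "0 < x $ i"
  show "G r (x - axis i 1) - G r x \<le> - (2 / sqrt (\<rho> r) * max 0 (q r x i - \<gamma>)) + 1 / w i / \<rho> r"
    using excess_upd[of "q r x" i "- (1 / (w i * s))"]
    unfolding q_down[OF x] s_def[symmetric] wd s(2) using s(1) w_ne[of i] by (simp add: power_divide fun_upd_def)
qed

lemma sum_rates_le:
  assumes r: "0 < r" and c: "\<And>i. 0 \<le> c i"
  shows "(\<Sum>i\<in>UNIV. (arr r x i + chg r x i) * c i) \<le> total_rate * real r * (\<Sum>i\<in>UNIV. w i * c i)"
proof -
  have "(\<Sum>i\<in>UNIV. (arr r x i + chg r x i) * c i) \<le> (\<Sum>i\<in>UNIV. total_rate * real r * w i * c i)"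
    using rates_le[OF r] c by (intro sum_mono mult_right_mono) auto
  then show ?thesis by (simp add: sum_distrib_left mult.assoc)
qed

lemma mean_excess_le: "(\<Sum>i\<in>UNIV. w i * max 0 (f i - \<gamma>)) \<le> sqrt (excess f)"
  using mean_sq_le[of "\<lambda>i. max 0 (f i - \<gamma>)"] by (intro real_le_rsqrt) (simp add: mean_def excess_def)

text \<open>
  Where a queue is above \<open>\<gamma>\<close>, all charging points are busy and work at a rate of at least
  $\lambda r + \mu \gamma \sqrt\rho$ per unit of weight. The arrivals, in total at most $\lambda r$, go to stations
  with a smaller excess on average than stations chosen according to their weights would have. So the terms of order
  $r$ cancel in the favourable direction.
\<close>

lemma drift_excess:
  assumes r: "0 < r"
  shows "jump_drift (rates r) (G r) x \<le> 2 * mu * \<bar>\<gamma>\<bar> * sqrt (G r x) + total_rate * CARD('s) * mu / lam"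
proof -
  define s where "s = sqrt (\<rho> r)"
  have s: "0 < s" "\<rho> r = s\<^sup>2" using \<rho>_pos[OF r] by (auto simp: s_def)
  define e where "e i = max 0 (q r x i - \<gamma>)" for i
  define m where "m = (\<Sum>i\<in>UNIV. w i * e i)"
  have e0: "0 \<le> e i" for i by (simp add: e_def)
  have m: "0 \<le> m" "m \<le> sqrt (G r x)"
    using mean_excess_le[of "q r x"] w_pos by (auto simp: m_def e_def less_imp_le intro!: sum_nonneg)
  have "(\<Sum>i\<in>UNIV. arr r x i * e i) = demand_rate r x * (m - pair_disparity e / 4)"
    unfolding m_def by (rule sum_arr[OF r]) (auto simp: e_def)
  also have "\<dots> \<le> demand_rate r x * m"
    using pair_disparity_nonneg[of e] demand_rate_bounds[of r x] by (intro mult_left_mono) auto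
  also have "\<dots> \<le> lam * real r * m"
    using m demand_rate_bounds[of r x] by (intro mult_right_mono) auto
  finally have arrivals: "(\<Sum>i\<in>UNIV. arr r x i * e i) \<le> lam * real r * m" .
  have "w i * (mu * (\<rho> r + s * \<gamma>)) * e i \<le> chg r x i * e i" for i
  proof (cases "q r x i \<le> \<gamma>")
    case True
    then show ?thesis by (simp add: e_def)
  next
    case False
    then have "min (\<rho> r + s * q r x i) (\<rho> r + s * \<gamma>) = \<rho> r + s * \<gamma>" using s by simp
    then have "mu * (\<rho> r + s * \<gamma>) \<le> service r (q r x i)"
      unfolding service_def s_def[symmetric] using mu by simp
    then show ?thesis using e0 w_pos[of i] unfolding chg_eq[OF r]
      by (intro mult_right_mono mult_left_mono) auto
  qed
  then have "(\<Sum>i\<in>UNIV. w i * (mu * (\<rho> r + s * \<gamma>)) * e i) \<le> (\<Sum>i\<in>UNIV. chg r x i * e i)"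
    by (rule sum_mono)
  also have "(\<Sum>i\<in>UNIV. w i * (mu * (\<rho> r + s * \<gamma>)) * e i) = mu * (\<rho> r + s * \<gamma>) * m"
    by (simp add: m_def sum_distrib_left sum_distrib_right mult_ac)
  also have "mu * (\<rho> r + s * \<gamma>) * m = lam * real r * m + s * (mu * \<gamma> * m)"
    using mu by (simp add: field_simps)
  finally have departures: "lam * real r * m + s * (mu * \<gamma> * m) \<le> (\<Sum>i\<in>UNIV. chg r x i * e i)" .
  have "jump_drift (rates r) (G r) x
      \<le> (\<Sum>i\<in>UNIV. arr r x i * (2 / s * e i + 1 / w i / \<rho> r) + chg r x i * (- (2 / s * e i) + 1 / w i / \<rho> r))"
    unfolding e_def s_def by (intro jump_drift_rates_le excess_jump r)
  also have "\<dots> = 2 / s * ((\<Sum>i\<in>UNIV. arr r x i * e i) - (\<Sum>i\<in>UNIV. chg r x i * e i))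
                  + (\<Sum>i\<in>UNIV. (arr r x i + chg r x i) * (1 / w i / \<rho> r))"
    by (simp add: sum.distrib sum_subtractf sum_distrib_left algebra_simps)
  also have "\<dots> \<le> 2 / s * (- (s * (mu * \<gamma> * m))) + total_rate * real r * (\<Sum>i\<in>UNIV. w i * (1 / w i / \<rho> r))"
    using arrivals departures s r w_pos lam mu
    by (intro add_mono mult_left_mono sum_rates_le) (auto simp: less_imp_le)
  also have "2 / s * (- (s * (mu * \<gamma> * m))) = 2 * mu * (- \<gamma>) * m"
    using s by simp
  also have "\<dots> \<le> 2 * mu * \<bar>\<gamma>\<bar> * sqrt (G r x)"
    using m mu by (intro mult_mono mult_left_mono[of "- \<gamma>" "\<bar>\<gamma>\<bar>" "2 * mu"]) auto
  also have "total_rate * real r * (\<Sum>i\<in>UNIV. w i * (1 / w i / \<rho> r)) = total_rate * CARD('s) * mu / lam"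
    using w_ne r lam by simp
  finally show ?thesis by simp
qed

text \<open>
  The EVs waiting at a station correspond to the part of its scaled queue above \<open>\<beta>\<close>, which is at most
  the part above \<open>\<gamma>\<close>. By the Cauchy-Schwarz inequality at most
  $\sqrt{\rho\, G}$ EVs are waiting, and the bound on the excess is chosen to make this $r/2$.
\<close>

lemma demand_rate_ge:
  assumes r: "0 < r" and G: "G r x \<le> mu / (4 * lam) * real r"
  shows "lam * real r / 2 \<le> demand_rate r x"
proof -
  define s where "s = sqrt (\<rho> r)"
  have s: "0 < s" "\<rho> r = s\<^sup>2" using \<rho>_pos[OF r] by (auto simp: s_def)
  have "(\<Sum>j\<in>UNIV. max 0 (real (x $ j) - spare_batteries p lam mu \<beta> r j))
          \<le> (\<Sum>j\<in>UNIV. s * (w j * max 0 (q r x j - \<gamma>)))"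
  proof (intro sum_mono)
    fix j
    have "real (x $ j) - spare_batteries p lam mu \<beta> r j = (s * w j) * (q r x j - \<beta>)"
      unfolding content_eq[OF r] spare_batteries_def s_def[symmetric] by (simp add: algebra_simps)
    also have "max 0 \<dots> \<le> (s * w j) * max 0 (q r x j - \<gamma>)"
      using s w_pos[of j] \<gamma>\<beta> by (intro max.boundedI mult_left_mono mult_nonneg_nonneg) auto
    finally show "max 0 (real (x $ j) - spare_batteries p lam mu \<beta> r j) \<le> s * (w j * max 0 (q r x j - \<gamma>))"
      by (simp add: mult.assoc)
  qed
  also have "\<dots> = s * (\<Sum>j\<in>UNIV. w j * max 0 (q r x j - \<gamma>))"
    by (simp add: sum_distrib_left)
  also have "\<dots> \<le> s * sqrt (G r x)"
    using s by (intro mult_left_mono mean_excess_le) auto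
  also have "\<dots> \<le> s * sqrt (mu / (4 * lam) * real r)"
    using s G by (intro mult_left_mono real_sqrt_le_mono) auto
  also have "\<dots> = sqrt ((real r / 2)\<^sup>2)"
    unfolding s_def real_sqrt_mult[symmetric] using lam mu by (simp add: power2_eq_square)
  also have "\<dots> = real r / 2" by simp
  finally have "real r / 2 \<le> non_waiting_EVs p lam mu \<beta> r x"
    by (simp add: non_waiting_EVs_def)
  then show ?thesis using lam by (simp add: demand_rate_def)
qed

text \<open>
  With $\Delta$ the increment of $V$ at a jump, $V^2$ increases by $2 V \Delta + \Delta^2$. Up to a
  remainder of order $1/r$, $\Delta$ is $\pm 2/\sqrt\rho$ times the deviation of the queue from the mean. This main part
  yields the cubic term through the routing rule and the connectedness of the graph; its square is
  $O(V/r)$, which yields a multiple of $V$ as there are $O(r)$ jumps per unit of time.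
\<close>

lemma drift_spread_sq:
  obtains c C where "0 < c" "0 < C"
    "\<And>r x. 0 < r \<Longrightarrow> G r x \<le> mu / (4 * lam) * real r \<Longrightarrow>
       jump_drift (rates r) (\<lambda>y. (V r y)\<^sup>2) x
         \<le> - c * sqrt (real r) * sqrt (V r x) ^ 3 + C * V r x + C / real r"
proof -
  obtain C0 where C0: "0 < C0" "\<And>f. sqrt (spread f) \<le> C0 * pair_disparity f"
    using spread_le_disparity by blast
  \<comment> \<open>The routing rule decreases $V$ at rate at least $(2/\sqrt\rho) (\lambda r/2) \sqrt V / (4 C_0)$; multiplied by $2 V$ this is
    $c \sqrt r\, V^{3/2}$.\<close>
  define c where "c = lam / (2 * C0 * sqrt (lam / mu))"
  define K where "K = (\<Sum>i\<in>UNIV. 1 / w i)"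
  define C where "C = (2 * CARD('s) + 8) * (total_rate * mu / lam) + 2 * K * total_rate * (mu / lam)\<^sup>2"
  have K: "0 \<le> K" unfolding K_def using w_pos by (intro sum_nonneg) (auto simp: less_imp_le)
  have c: "0 < c" using lam mu C0 by (simp add: c_def)
  have C: "0 < C" using lam mu K total_rate_pos unfolding C_def
    by (intro add_pos_nonneg mult_pos_pos mult_nonneg_nonneg) auto
  have "jump_drift (rates r) (\<lambda>y. (V r y)\<^sup>2) x
         \<le> - c * sqrt (real r) * sqrt (V r x) ^ 3 + C * V r x + C / real r"
    if r: "0 < r" and G: "G r x \<le> mu / (4 * lam) * real r" for r x
  proof -
    define s where "s = sqrt (\<rho> r)"
    have s: "0 < s" "\<rho> r = s\<^sup>2" using \<rho>_pos[OF r] by (auto simp: s_def)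
    define v where "v i = q r x i - mean (q r x)" for i
    define e where "e i = (1 / w i - 1) / \<rho> r" for i
    have e: "0 \<le> e i" "e i \<le> 1 / w i / \<rho> r" for i
    proof -
      have "0 \<le> 1 / w i - 1" using w_le[of i] w_pos[of i] by simp
      then show "0 \<le> e i" "e i \<le> 1 / w i / \<rho> r"
        unfolding e_def using r lam mu by (intro divide_nonneg_pos divide_right_mono; simp)+
    qed
    let ?V = "V r x"
    have V: "0 \<le> ?V" by (rule spread_nonneg)
    let ?u = "\<lambda>i. 2 * ?V * (2 / s * v i + e i) + (8 / \<rho> r * (v i)\<^sup>2 + 2 * (e i)\<^sup>2)"
    let ?d = "\<lambda>i. 2 * ?V * (- (2 / s * v i) + e i) + (8 / \<rho> r * (v i)\<^sup>2 + 2 * (e i)\<^sup>2)"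
    have sq: "a\<^sup>2 - ?V\<^sup>2 \<le> 2 * ?V * (y + z) + (2 * y\<^sup>2 + 2 * z\<^sup>2)" if "a - ?V = y + z" for a y z
    proof -
      have a: "a = ?V + (y + z)" using that by simp
      have "0 \<le> (y - z)\<^sup>2" by simp
      then show ?thesis unfolding a by (simp add: power2_eq_square algebra_simps)
    qed
    have v2: "2 * (2 / s * v i)\<^sup>2 = 8 / \<rho> r * (v i)\<^sup>2" "2 * (- (2 / s * v i))\<^sup>2 = 8 / \<rho> r * (v i)\<^sup>2" for i
      unfolding s(2) by (simp_all add: power_mult_distrib power_divide)
    have "jump_drift (rates r) (\<lambda>y. (V r y)\<^sup>2) x
            \<le> (\<Sum>i\<in>UNIV. arr r x i * ?u i + chg r x i * ?d i)"
    proof (rule jump_drift_rates_le)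
      show "(V r (x + axis i 1))\<^sup>2 - ?V\<^sup>2 \<le> ?u i" for i
        using sq[OF spread_jump(1)[OF r, of x i, folded s_def v_def e_def]] unfolding v2 .
      show "(V r (x - axis i 1))\<^sup>2 - ?V\<^sup>2 \<le> ?d i" if "0 < x $ i" for i
        using sq[OF spread_jump(2)[OF r that, folded s_def v_def e_def]] unfolding v2 .
    qed
    also have "\<dots> = 4 * ?V / s * ((\<Sum>i\<in>UNIV. arr r x i * v i) - (\<Sum>i\<in>UNIV. chg r x i * v i))
         + 2 * ?V * (\<Sum>i\<in>UNIV. (arr r x i + chg r x i) * e i)
         + 8 / \<rho> r * (\<Sum>i\<in>UNIV. (arr r x i + chg r x i) * (v i)\<^sup>2)
         + 2 * (\<Sum>i\<in>UNIV. (arr r x i + chg r x i) * (e i)\<^sup>2)"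
      by (simp add: sum.distrib sum_subtractf sum_distrib_left sum_divide_distrib distrib_left distrib_right
            right_diff_distrib mult_ac)
    also have "\<dots> \<le> 4 * ?V / s * (- (lam * real r / 8 * (sqrt ?V / C0)))
         + 2 * ?V * (total_rate * CARD('s) * mu / lam)
         + 8 / \<rho> r * (total_rate * real r * ?V)
         + 2 * (total_rate * real r * (K / (\<rho> r)\<^sup>2))"
    proof (intro add_mono mult_left_mono)
      have "(\<Sum>i\<in>UNIV. arr r x i * v i)
              = demand_rate r x * ((\<Sum>i\<in>UNIV. w i * v i) - pair_disparity v / 4)"
        by (rule sum_arr[OF r]) (auto simp: v_def)
      also have "(\<Sum>i\<in>UNIV. w i * v i) = 0" unfolding v_def by (rule sum_w_centred)
      also have "pair_disparity v = pair_disparity (q r x)" by (simp add: pair_disparity_def v_def)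
      finally have "(\<Sum>i\<in>UNIV. arr r x i * v i) = - (demand_rate r x * (pair_disparity (q r x) / 4))"
        by simp
      moreover have "lam * real r / 2 * (sqrt ?V / C0 / 4) \<le> demand_rate r x * (pair_disparity (q r x) / 4)"
        using C0 V lam demand_rate_bounds[of r x]
        by (intro mult_mono demand_rate_ge r G divide_right_mono) (auto simp: field_simps)
      moreover have "0 \<le> (\<Sum>i\<in>UNIV. chg r x i * v i)"
        unfolding v_def by (rule sum_chg_centred_nonneg[OF r])
      ultimately show "(\<Sum>i\<in>UNIV. arr r x i * v i) - (\<Sum>i\<in>UNIV. chg r x i * v i)
          \<le> - (lam * real r / 8 * (sqrt ?V / C0))" by (simp add: field_simps)
      have "(\<Sum>i\<in>UNIV. (arr r x i + chg r x i) * e i) \<le> total_rate * real r * (\<Sum>i\<in>UNIV. w i * e i)"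
        using e by (intro sum_rates_le r)
      also have "\<dots> \<le> total_rate * real r * (\<Sum>i\<in>UNIV. w i * (1 / w i / \<rho> r))"
        using e w_pos total_rate_pos by (intro mult_left_mono sum_mono) (auto simp: less_imp_le)
      also have "\<dots> = total_rate * CARD('s) * mu / lam"
        using w_ne r lam by simp
      finally show "(\<Sum>i\<in>UNIV. (arr r x i + chg r x i) * e i) \<le> total_rate * CARD('s) * mu / lam" .
      show "(\<Sum>i\<in>UNIV. (arr r x i + chg r x i) * (v i)\<^sup>2) \<le> total_rate * real r * ?V"
        unfolding spread_def v_def[symmetric] by (intro sum_rates_le r) auto
      have "(\<Sum>i\<in>UNIV. (arr r x i + chg r x i) * (e i)\<^sup>2) \<le> total_rate * real r * (\<Sum>i\<in>UNIV. w i * (e i)\<^sup>2)"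
        by (intro sum_rates_le r) auto
      also have "\<dots> \<le> total_rate * real r * (\<Sum>i\<in>UNIV. w i * (1 / w i / \<rho> r)\<^sup>2)"
        using e w_pos total_rate_pos by (intro mult_left_mono sum_mono power_mono) (auto simp: less_imp_le)
      also have "(\<Sum>i\<in>UNIV. w i * (1 / w i / \<rho> r)\<^sup>2) = K / (\<rho> r)\<^sup>2"
        unfolding K_def sum_divide_distrib using w_ne
        by (intro sum.cong) (simp_all add: power2_eq_square)
      finally show "(\<Sum>i\<in>UNIV. (arr r x i + chg r x i) * (e i)\<^sup>2) \<le> total_rate * real r * (K / (\<rho> r)\<^sup>2)" .
    qed (use V s lam mu in auto)
    also have "4 * ?V / s * (- (lam * real r / 8 * (sqrt ?V / C0))) = - c * sqrt (real r) * sqrt ?V ^ 3"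
    proof -
      have "s = sqrt (lam / mu) * sqrt (real r)"
        unfolding s_def by (simp add: real_sqrt_mult real_sqrt_divide)
      moreover have "?V * sqrt ?V = sqrt ?V ^ 3" using V by (simp add: power3_eq_cube)
      moreover have "real r = sqrt (real r) * sqrt (real r)" by simp
      ultimately show ?thesis using C0 lam mu r unfolding c_def
        by (simp add: field_simps del: real_sqrt_mult_self)
    qed
    also have "2 * (total_rate * real r * (K / (\<rho> r)\<^sup>2)) = 2 * K * total_rate * (mu / lam)\<^sup>2 / real r"
      using r lam mu by (simp add: power2_eq_square field_simps)
    also have "\<dots> \<le> C / real r"
      using total_rate_pos lam mu unfolding C_def by (intro divide_right_mono) auto
    also have "8 / \<rho> r * (total_rate * real r * ?V) = 8 * (total_rate * mu / lam) * ?V"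
      using r by simp
    finally have *: "jump_drift (rates r) (\<lambda>y. (V r y)\<^sup>2) x \<le> - c * sqrt (real r) * sqrt ?V ^ 3
        + 2 * ?V * (total_rate * CARD('s) * mu / lam) + 8 * (total_rate * mu / lam) * ?V + C / real r"
      by simp
    have "((2 * CARD('s) + 8) * (total_rate * mu / lam)) * ?V \<le> C * ?V"
      using V K total_rate_pos unfolding C_def by (intro mult_right_mono) auto
    then have "2 * ?V * (total_rate * CARD('s) * mu / lam) + 8 * (total_rate * mu / lam) * ?V \<le> C * ?V"
      by (simp add: algebra_simps)
    then show ?thesis using * by linarith
  qed
  then show ?thesis using that c C by blast
qed

end

section \<open>Hitting bound for the spread\<close>

lemma finite_bounded_vectors: "finite {x :: nat ^ 's::finite. \<forall>i. x $ i \<le> n}"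
proof (rule finite_subset)
  show "{x :: nat ^ 's. \<forall>i. x $ i \<le> n} \<subseteq> vec_lambda ` (PiE UNIV (\<lambda>_. {..n}))"
  proof
    fix x :: "nat ^ 's" assume "x \<in> {x. \<forall>i. x $ i \<le> n}"
    then show "x \<in> vec_lambda ` (PiE UNIV (\<lambda>_. {..n}))"
      by (intro image_eqI[of _ _ "vec_nth x"]) auto
  qed
qed (intro finite_imageI finite_PiE, auto)

text \<open>
  The quadratic term exceeds the cubic one only for $s < C/(c R)$, and there it is itself of order $1/R^2$.
  This makes the upper bound on the drift of $V^2$ vanish in the limit, with $R = \sqrt r$.
\<close>

lemma cubic_dominates_square:
  fixes c C R s :: real
  assumes "0 < c" "0 \<le> C" "0 < R" "0 \<le> s"
  shows "- c * R * s ^ 3 + C * s\<^sup>2 \<le> C ^ 3 / c\<^sup>2 / R\<^sup>2"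
proof (cases "C \<le> c * R * s")
  case True
  have "- c * R * s ^ 3 + C * s\<^sup>2 = s\<^sup>2 * (C - c * R * s)"
    by (simp add: power2_eq_square power3_eq_cube algebra_simps)
  also have "\<dots> \<le> 0" using True by (simp add: mult_nonneg_nonpos)
  also have "\<dots> \<le> C ^ 3 / c\<^sup>2 / R\<^sup>2" using assms by simp
  finally show ?thesis .
next
  case False
  then have "s \<le> C / (c * R)" using assms by (simp add: field_simps)
  then have "s\<^sup>2 \<le> (C / (c * R))\<^sup>2" using assms by (intro power_mono) auto
  then have "C * s\<^sup>2 \<le> C * (C / (c * R))\<^sup>2" using assms by (intro mult_left_mono) auto
  also have "\<dots> = C ^ 3 / c\<^sup>2 / R\<^sup>2" by (simp add: power2_eq_square power3_eq_cube mult_ac)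
  finally have "C * s\<^sup>2 \<le> C ^ 3 / c\<^sup>2 / R\<^sup>2" .
  moreover have "0 \<le> c * R * s ^ 3" using assms by simp
  ultimately show ?thesis by simp
qed

context swapping_network
begin

text \<open>
  Scaled queues with bounded excess are bounded from above, and queue lengths are natural numbers.
\<close>

lemma finite_excess_less:
  assumes r: "0 < r" shows "finite {x. G r x < a}"
proof (rule finite_subset[OF _ finite_bounded_vectors])
  define s where "s = sqrt (\<rho> r)"
  have s: "0 < s" using \<rho>_pos[OF r] by (auto simp: s_def)
  define m where "m = Min (range w)"
  have m: "0 < m" "m \<le> w i" for i unfolding m_def by (subst Min_gr_iff) (auto simp: w_pos)
  define B where "B = \<rho> r + s * (\<bar>\<gamma>\<bar> + sqrt (\<bar>a\<bar> / m))"
  show "{x. G r x < a} \<subseteq> {x. \<forall>i. x $ i \<le> nat \<lfloor>B\<rfloor>}"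
  proof safe
    fix x i assume x: "G r x < a"
    have "m * (max 0 (q r x i - \<gamma>))\<^sup>2 \<le> w i * (max 0 (q r x i - \<gamma>))\<^sup>2"
      using m by (intro mult_right_mono) auto
    also have "\<dots> \<le> G r x"
      unfolding excess_def using w_pos
      by (intro member_le_sum[of i UNIV "\<lambda>i. w i * (max 0 (q r x i - \<gamma>))\<^sup>2"]) (auto simp: less_imp_le)
    finally have "(max 0 (q r x i - \<gamma>))\<^sup>2 \<le> \<bar>a\<bar> / m"
      using x m by (simp add: field_simps)
    then have "max 0 (q r x i - \<gamma>) \<le> sqrt (\<bar>a\<bar> / m)" by (rule real_le_rsqrt)
    then have "q r x i \<le> \<bar>\<gamma>\<bar> + sqrt (\<bar>a\<bar> / m)" by linarith
    then have "\<rho> r + s * q r x i \<le> B" using s by (simp add: B_def)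
    moreover have "real (x $ i) \<le> \<rho> r + s * q r x i"
    proof -
      have "0 \<le> \<rho> r + s * q r x i"
        using content_eq[OF r, of x i, folded s_def] w_pos[of i] by (metis of_nat_0_le_iff zero_le_mult_iff not_le)
      then have "w i * (\<rho> r + s * q r x i) \<le> 1 * (\<rho> r + s * q r x i)"
        using w_le by (intro mult_right_mono) auto
      then show ?thesis using content_eq[OF r, of x i, folded s_def] by simp
    qed
    ultimately show "x $ i \<le> nat \<lfloor>B\<rfloor>" by (intro le_nat_floor) linarith
  qed
qed

text \<open>
  Bounds for a fixed number \<open>r\<close> of EVs, with constants independent of \<open>r\<close>, of the level \<open>\<epsilon>\<close> and of the
  parameter \<open>b\<close>. A larger \<open>b\<close> makes the exit from the region $V < b^2$ less likely but slows down the
  guaranteed decay of $V^2$, whose rate there is of order $\sqrt r / b$.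
\<close>

lemma spread_hitting:
  obtains \<kappa> C :: real where "0 < \<kappa>" "0 < C"
    "\<And>r b \<epsilon> t0 T (M :: 'w measure) X. 0 < r \<Longrightarrow> 1 \<le> b \<Longrightarrow> 0 < \<epsilon> \<Longrightarrow> 0 \<le> t0 \<Longrightarrow> 0 < T \<Longrightarrow>
       markov_jump_process M X (rates r) \<Longrightarrow>
       \<exists>E\<in>sets M. {\<omega>\<in>space M. \<exists>t\<in>{t0..<T}. \<epsilon> \<le> V r (X t \<omega>)} \<subseteq> E \<and>
         measure M E \<le> (\<integral>\<omega>. min 1 (1 / b ^ 4 * (V r (X 0 \<omega>))\<^sup>2 + 4 * lam / mu / real r * G r (X 0 \<omega>)
             + exp (- (\<kappa> * sqrt (real r) / b) * t0) * (1 / \<epsilon>\<^sup>2 * (V r (X 0 \<omega>))\<^sup>2)) \<partial>M)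
           + C / sqrt (real r) * (1 + 1 / \<epsilon>\<^sup>2) * T"
proof -
  obtain c C1 where c: "0 < c" "0 < C1" and drift_V:
    "\<And>r x. 0 < r \<Longrightarrow> G r x \<le> mu / (4 * lam) * real r \<Longrightarrow>
       jump_drift (rates r) (\<lambda>y. (V r y)\<^sup>2) x
         \<le> - c * sqrt (real r) * sqrt (V r x) ^ 3 + C1 * V r x + C1 / real r"
    using drift_spread_sq by blast
  define \<alpha> where "\<alpha> = mu / (4 * lam)"
  have \<alpha>: "0 < \<alpha>" "4 * lam / mu = 1 / \<alpha>" using lam mu by (auto simp: \<alpha>_def)
  \<comment> \<open>Half of the cubic term pays for the decay of $V^2$, the other half for the noise.\<close>
  define \<kappa> where "\<kappa> = c / 2"
  define C2 where "C2 = C1 ^ 3 / \<kappa>\<^sup>2 + C1"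
  define C3 where "C3 = (2 * mu * \<bar>\<gamma>\<bar> * sqrt \<alpha> + total_rate * CARD('s) * mu / lam) / \<alpha>"
  have \<kappa>: "0 < \<kappa>" using c by (simp add: \<kappa>_def)
  have C2: "0 < C2" using c \<kappa> by (auto simp: C2_def intro!: add_pos_pos)
  have C3: "0 \<le> C3" using mu lam \<alpha> total_rate_pos
    by (auto simp: C3_def intro!: divide_nonneg_pos add_nonneg_nonneg mult_nonneg_nonneg)
  have main: "\<exists>E\<in>sets M. {\<omega>\<in>space M. \<exists>t\<in>{t0..<T}. \<epsilon> \<le> V r (X t \<omega>)} \<subseteq> E \<and>
         measure M E \<le> (\<integral>\<omega>. min 1 (1 / b ^ 4 * (V r (X 0 \<omega>))\<^sup>2 + 4 * lam / mu / real r * G r (X 0 \<omega>)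
             + exp (- (\<kappa> * sqrt (real r) / b) * t0) * (1 / \<epsilon>\<^sup>2 * (V r (X 0 \<omega>))\<^sup>2)) \<partial>M)
           + (C2 + C3) / sqrt (real r) * (1 + 1 / \<epsilon>\<^sup>2) * T"
    if r: "0 < r" and b: "1 \<le> b" and \<epsilon>: "0 < \<epsilon>" and t0: "0 \<le> t0" and T: "0 < T"
      and X: "markov_jump_process M X (rates r)" for r b \<epsilon> t0 T and M :: "'w measure" and X
  proof -
    define R where "R = sqrt (real r)"
    have R: "0 < R" "1 \<le> R" "real r = R * R" "R\<^sup>2 = real r" using r by (auto simp: R_def)
    define \<psi> where "\<psi> x = 1 / b ^ 4 * (V r x)\<^sup>2 + 1 / (\<alpha> * real r) * G r x" for x
    define \<phi> where "\<phi> x = 1 / \<epsilon>\<^sup>2 * (V r x)\<^sup>2" for x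
    have inside: "G r x < \<alpha> * real r" "sqrt (V r x) < b" if "\<psi> x < 1" for x
    proof -
      have "0 \<le> 1 / (\<alpha> * real r) * G r x" "0 \<le> 1 / b ^ 4 * (V r x)\<^sup>2"
        using \<alpha> excess_nonneg by auto
      then have "1 / (\<alpha> * real r) * G r x < 1" "1 / b ^ 4 * (V r x)\<^sup>2 < 1"
        using that unfolding \<psi>_def by linarith+
      then have *: "G r x < \<alpha> * real r" "(V r x)\<^sup>2 < b ^ 4"
        using r b \<alpha> by (auto simp: pos_divide_less_eq)
      then have "(V r x)\<^sup>2 < (b\<^sup>2)\<^sup>2" by (simp add: power_mult[symmetric])
      then have "V r x < b\<^sup>2" by (rule power2_less_imp_less) simp
      then have "sqrt (V r x) < b" using b by (simp add: real_less_lsqrt)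
      with * show "G r x < \<alpha> * real r" "sqrt (V r x) < b" by auto
    qed
    have inv: "1 / real r \<le> 1 / R" using R by (simp add: field_simps)
    have dV: "\<kappa> * R / b * (V r x)\<^sup>2 + jump_drift (rates r) (\<lambda>y. (V r y)\<^sup>2) x \<le> C2 / R" if x: "\<psi> x < 1" for x
    proof -
      define s where "s = sqrt (V r x)"
      have s: "0 \<le> s" "V r x = s\<^sup>2" "s < b" using inside[OF x] spread_nonneg by (auto simp: s_def)
      have "\<kappa> * R / b * (V r x)\<^sup>2 = \<kappa> * R * s ^ 3 * (s / b)"
        by (simp add: s(2) power2_eq_square power3_eq_cube)
      also have "\<dots> \<le> \<kappa> * R * s ^ 3 * 1"
        using \<kappa> R s b by (intro mult_left_mono) auto
      finally have "\<kappa> * R / b * (V r x)\<^sup>2 \<le> \<kappa> * R * s ^ 3" by simp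
      moreover have "jump_drift (rates r) (\<lambda>y. (V r y)\<^sup>2) x \<le> - (2 * \<kappa>) * R * s ^ 3 + C1 * V r x + C1 / real r"
        using drift_V[OF r, of x] inside(1)[OF x] unfolding R_def[symmetric] s_def[symmetric]
        by (simp add: \<alpha>_def \<kappa>_def)
      ultimately have "\<kappa> * R / b * (V r x)\<^sup>2 + jump_drift (rates r) (\<lambda>y. (V r y)\<^sup>2) x
          \<le> - \<kappa> * R * s ^ 3 + C1 * s\<^sup>2 + C1 / real r"
        unfolding s(2) by (simp add: algebra_simps)
      also have "\<dots> \<le> C1 ^ 3 / \<kappa>\<^sup>2 / R\<^sup>2 + C1 / real r"
        using cubic_dominates_square[of \<kappa> C1 R s] \<kappa> c R s by simp
      also have "\<dots> = C2 * (1 / real r)" using R by (simp add: C2_def add_divide_distrib)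
      also have "\<dots> \<le> C2 * (1 / R)" using C2 inv by (intro mult_left_mono) auto
      finally show ?thesis by simp
    qed
    have dG: "1 / (\<alpha> * real r) * jump_drift (rates r) (G r) x \<le> C3 / R" if x: "\<psi> x < 1" for x
    proof -
      have "jump_drift (rates r) (G r) x
              \<le> 2 * mu * \<bar>\<gamma>\<bar> * sqrt (G r x) + total_rate * CARD('s) * mu / lam"
        by (rule drift_excess[OF r])
      also have "\<dots> \<le> 2 * mu * \<bar>\<gamma>\<bar> * (sqrt \<alpha> * R) + total_rate * CARD('s) * mu / lam * R"
      proof (intro add_mono mult_left_mono)
        have "sqrt (G r x) \<le> sqrt (\<alpha> * real r)" using inside(1)[OF x] by simp
        then show "sqrt (G r x) \<le> sqrt \<alpha> * R" by (simp add: R_def real_sqrt_mult)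
        have "0 \<le> total_rate * CARD('s) * mu / lam" using total_rate_pos mu lam by simp
        from mult_left_mono[OF R(2) this]
        show "total_rate * CARD('s) * mu / lam \<le> total_rate * CARD('s) * mu / lam * R" by simp
      qed (use mu in auto)
      also have "\<dots> = C3 * \<alpha> * R"
      proof -
        have "C3 * \<alpha> = 2 * mu * \<bar>\<gamma>\<bar> * sqrt \<alpha> + total_rate * CARD('s) * mu / lam"
          using \<alpha>(1) by (simp add: C3_def)
        then show ?thesis by (simp only: distrib_right mult.assoc)
      qed
      finally have "1 / (\<alpha> * real r) * jump_drift (rates r) (G r) x \<le> 1 / (\<alpha> * real r) * (C3 * \<alpha> * R)"
        using \<alpha> by (intro mult_left_mono) auto
      also have "\<dots> = C3 / R" using \<alpha> R by (simp add: R(3))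
      finally show ?thesis .
    qed
    obtain E where E: "E \<in> sets M" "{\<omega>\<in>space M. \<exists>t\<in>{t0..<T}. 1 \<le> \<phi> (X t \<omega>)} \<subseteq> E"
      "measure M E \<le> (\<integral>\<omega>. min 1 (\<psi> (X 0 \<omega>) + exp (- (\<kappa> * R / b) * t0) * \<phi> (X 0 \<omega>)) \<partial>M)
          + ((C2 + C3) / R + C2 / R / \<epsilon>\<^sup>2) * T"
    proof (rule markov_jump_process_hitting[OF X, of \<phi> \<psi> "(C2 + C3) / R" "\<kappa> * R / b" "C2 / R / \<epsilon>\<^sup>2" t0 T])
      show "finite {x. \<psi> x < 1}"
        by (rule finite_subset[OF _ finite_excess_less[OF r]]) (use inside in blast)
      show "jump_drift (rates r) \<psi> x \<le> (C2 + C3) / R" if x: "\<psi> x < 1" for x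
      proof -
        have "jump_drift (rates r) (\<lambda>y. (V r y)\<^sup>2) x \<le> C2 / R"
        proof -
          have "0 \<le> \<kappa> * R / b * (V r x)\<^sup>2" using \<kappa> R b by simp
          then show ?thesis using dV[OF x] by linarith
        qed
        then have "1 / b ^ 4 * jump_drift (rates r) (\<lambda>y. (V r y)\<^sup>2) x \<le> 1 / b ^ 4 * (C2 / R)"
          by (intro mult_left_mono) auto
        also have "\<dots> \<le> 1 * (C2 / R)"
          using b C2 R by (intro mult_right_mono) auto
        finally have "1 / b ^ 4 * jump_drift (rates r) (\<lambda>y. (V r y)\<^sup>2) x \<le> C2 / R" by simp
        with dG[OF x] show ?thesis
          unfolding \<psi>_def[abs_def] jump_drift_add_scaled jump_drift_scaled by (simp add: add_divide_distrib)
      qed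
      show "\<kappa> * R / b * \<phi> x + jump_drift (rates r) \<phi> x \<le> C2 / R / \<epsilon>\<^sup>2" if x: "\<psi> x < 1" for x
      proof -
        have "\<kappa> * R / b * \<phi> x + jump_drift (rates r) \<phi> x
            = 1 / \<epsilon>\<^sup>2 * (\<kappa> * R / b * (V r x)\<^sup>2 + jump_drift (rates r) (\<lambda>y. (V r y)\<^sup>2) x)"
          unfolding \<phi>_def[abs_def] jump_drift_scaled by (simp add: algebra_simps add_divide_distrib)
        also have "\<dots> \<le> 1 / \<epsilon>\<^sup>2 * (C2 / R)"
          using dV[OF x] by (intro mult_left_mono) auto
        finally show ?thesis by (simp add: mult.commute)
      qed
      show "0 \<le> \<phi> x" "0 \<le> \<psi> x" for x
        using \<alpha>(1) excess_nonneg[of "q r x"] by (simp_all add: \<phi>_def \<psi>_def)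
      show "0 \<le> (C2 + C3) / R" "0 \<le> C2 / R / \<epsilon>\<^sup>2" "0 \<le> \<kappa> * R / b"
        using \<kappa> C2 C3 R b by simp_all
      show "0 \<le> rates r x y" if "y \<noteq> x" for x y by (rule rates_nonneg)
      show "finite {y. y \<noteq> x \<and> rates r x y \<noteq> 0}" for x by (rule rates_finite)
    qed (rule t0, rule T, rule that)
    have "(C2 + C3) / R + C2 / R / \<epsilon>\<^sup>2 \<le> (C2 + C3) / R * (1 + 1 / \<epsilon>\<^sup>2)"
      using C3 R \<epsilon> by (simp add: field_simps)
    then have le: "((C2 + C3) / R + C2 / R / \<epsilon>\<^sup>2) * T \<le> (C2 + C3) / R * (1 + 1 / \<epsilon>\<^sup>2) * T"
      using T by (intro mult_right_mono) auto
    have "1 \<le> \<phi> (X t \<omega>)" if "\<epsilon> \<le> V r (X t \<omega>)" for t \<omega>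
      using that \<epsilon> by (simp add: \<phi>_def power_mono)
    then have "{\<omega>\<in>space M. \<exists>t\<in>{t0..<T}. \<epsilon> \<le> V r (X t \<omega>)} \<subseteq> E" using E(2) by blast
    note sub = this
    have meas: "measure M E \<le> (\<integral>\<omega>. min 1 (\<psi> (X 0 \<omega>) + exp (- (\<kappa> * R / b) * t0) * \<phi> (X 0 \<omega>)) \<partial>M)
        + (C2 + C3) / R * (1 + 1 / \<epsilon>\<^sup>2) * T"
      using E(3) le by linarith
    have eq: "4 * lam / mu / real r = 1 / (\<alpha> * real r)" using \<alpha> by simp
    show ?thesis unfolding eq
      by (rule bexI[of _ E], rule conjI, rule sub, rule meas[unfolded \<psi>_def \<phi>_def R_def], rule E(1))
  qed
  show ?thesis by (rule that[OF \<kappa> _ main]) (use C2 C3 in simp)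
qed

end

section \<open>Tightness and convergence in probability\<close>

text \<open>
  The bounded continuous functions $\min(1, (|y| - k)^+)$ lie below the indicator of $|y| > k$ and above
  that of $|y| > k + 1$; their expectations in the limit tend to $0$ as $k$ grows.
\<close>

lemma conv_in_distribution_tight:
  fixes Y :: "nat \<Rightarrow> 'w \<Rightarrow> 'b::{real_normed_vector, second_countable_topology}"
  assumes M: "\<And>r. prob_space (M r)" and Y: "\<And>r. Y r \<in> borel_measurable (M r)"
    and N: "prob_space N" and Y0: "Y0 \<in> borel_measurable N"
    and conv: "conv_in_distribution M Y N Y0" and \<eta>: "0 < \<eta>"
  shows "\<exists>R. \<forall>\<^sub>F r in sequentially. \<P>(\<omega> in M r. R < norm (Y r \<omega>)) < \<eta>"
proof -
  interpret N: prob_space N by (rule N)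
  define f :: "nat \<Rightarrow> 'b \<Rightarrow> real" where "f k y = min 1 (max 0 (norm y - real k))" for k y
  have f: "0 \<le> f k y" "f k y \<le> 1" for k y by (auto simp: f_def)
  have cont: "continuous_on UNIV (f k)" for k
    unfolding f_def by (intro continuous_intros)
  have [measurable]: "f k \<in> borel_measurable borel" for k
    by (intro borel_measurable_continuous_onI cont)
  note [measurable] = Y0 Y
  have "(\<lambda>k. \<integral>\<omega>. f k (Y0 \<omega>) \<partial>N) \<longlonglongrightarrow> (\<integral>\<omega>. 0 \<partial>N)"
  proof (rule integral_dominated_convergence[where w="\<lambda>_. 1"])
    show "AE \<omega> in N. (\<lambda>k. f k (Y0 \<omega>)) \<longlonglongrightarrow> 0"
    proof (intro AE_I2 tendsto_eventually)
      fix \<omega>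
      obtain K :: nat where "norm (Y0 \<omega>) \<le> real K" using real_arch_simple by blast
      then show "\<forall>\<^sub>F k in sequentially. f k (Y0 \<omega>) = 0"
        by (intro eventually_sequentiallyI[of K]) (auto simp: f_def)
    qed
  qed (use f in auto)
  then have "\<forall>\<^sub>F k in sequentially. (\<integral>\<omega>. f k (Y0 \<omega>) \<partial>N) < \<eta>"
    using \<eta> by (intro order_tendstoD) auto
  then obtain k where k: "(\<integral>\<omega>. f k (Y0 \<omega>) \<partial>N) < \<eta>"
    by (auto simp: eventually_sequentially)
  have "bounded (range (f k))"
    using f by (intro boundedI[of _ 1]) auto
  then have "(\<lambda>r. \<integral>\<omega>. f k (Y r \<omega>) \<partial>M r) \<longlonglongrightarrow> (\<integral>\<omega>. f k (Y0 \<omega>) \<partial>N)"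
    using conv cont unfolding conv_in_distribution_def by blast
  then have "\<forall>\<^sub>F r in sequentially. (\<integral>\<omega>. f k (Y r \<omega>) \<partial>M r) < \<eta>"
    using k by (rule order_tendstoD)
  then have "\<forall>\<^sub>F r in sequentially. \<P>(\<omega> in M r. real k + 1 < norm (Y r \<omega>)) < \<eta>"
  proof eventually_elim
    case (elim r)
    interpret prob_space "M r" by (rule M)
    have "prob {\<omega>\<in>space (M r). real k + 1 < norm (Y r \<omega>)}
            = expectation (indicator {\<omega>\<in>space (M r). real k + 1 < norm (Y r \<omega>)})"
      by simp
    also have "\<dots> \<le> expectation (\<lambda>\<omega>. f k (Y r \<omega>))"
      using f by (intro integral_mono integrable_const_bound[where B=1])
               (auto simp: f_def indicator_def)
    finally show ?case using elim by simp
  qed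
  then show ?thesis by blast
qed

lemma conv_in_probability_0_scaled_tight:
  assumes M: "\<And>r. prob_space (M r)" and Y: "\<And>r. Y r \<in> borel_measurable (M r)"
    and tight: "\<And>\<eta>::real. 0 < \<eta> \<Longrightarrow> \<exists>R. \<forall>\<^sub>F r in sequentially. \<P>(\<omega> in M r. R < norm (Y r \<omega>)) < \<eta>"
    and h: "\<And>R. \<exists>C. \<forall>y :: 'b::{real_normed_vector, second_countable_topology}. norm y \<le> R \<longrightarrow> \<bar>h y\<bar> \<le> C"
    and a: "a \<longlonglongrightarrow> 0"
  shows "conv_in_probability_0 M (\<lambda>r \<omega>. a r * h (Y r \<omega>))"
  unfolding conv_in_probability_0_def
proof (intro allI impI order_tendstoI)
  fix \<delta> \<eta> :: real assume \<delta>: "0 < \<delta>" and \<eta>: "0 < \<eta>"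
  obtain R where R: "\<forall>\<^sub>F r in sequentially. \<P>(\<omega> in M r. R < norm (Y r \<omega>)) < \<eta>"
    using tight[OF \<eta>] by blast
  obtain C where C: "\<And>y. norm y \<le> R \<Longrightarrow> \<bar>h y\<bar> \<le> C" using h by blast
  have "(\<lambda>r. \<bar>a r\<bar> * C) \<longlonglongrightarrow> 0"
    using tendsto_mult_right[OF tendsto_rabs_zero[OF a], of C] by simp
  then have "\<forall>\<^sub>F r in sequentially. \<bar>a r\<bar> * C < \<delta>" using \<delta> by (rule order_tendstoD)
  with R show "\<forall>\<^sub>F r in sequentially. \<P>(\<omega> in M r. \<delta> < \<bar>a r * h (Y r \<omega>)\<bar>) < \<eta>"
  proof eventually_elim
    case (elim r)
    interpret prob_space "M r" by (rule M)
    note [measurable] = Y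
    have "prob {\<omega>\<in>space (M r). \<delta> < \<bar>a r * h (Y r \<omega>)\<bar>} \<le> prob {\<omega>\<in>space (M r). R < norm (Y r \<omega>)}"
    proof (rule finite_measure_mono, safe, rule ccontr)
      fix \<omega> assume "\<delta> < \<bar>a r * h (Y r \<omega>)\<bar>" "\<not> R < norm (Y r \<omega>)"
      moreover from this have "\<bar>a r\<bar> * \<bar>h (Y r \<omega>)\<bar> \<le> \<bar>a r\<bar> * C"
        by (intro mult_left_mono C) auto
      ultimately show False using elim by (simp add: abs_mult)
    qed auto
    then show ?case using elim by simp
  qed
qed (auto intro!: always_eventually less_le_trans[OF _ measure_nonneg])

lemma conv_in_probability_0_add:
  assumes M: "\<And>r. prob_space (M r)"
    and m: "\<And>r. X r \<in> borel_measurable (M r)" "\<And>r. Y r \<in> borel_measurable (M r)"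
    and X: "conv_in_probability_0 M X" and Y: "conv_in_probability_0 M Y"
  shows "conv_in_probability_0 M (\<lambda>r \<omega>. X r \<omega> + Y r \<omega>)"
  unfolding conv_in_probability_0_def
proof (intro allI impI)
  fix \<delta> :: real assume \<delta>: "0 < \<delta>"
  note [measurable] = m
  have lim: "(\<lambda>r. \<P>(\<omega> in M r. \<bar>X r \<omega>\<bar> > \<delta> / 2) + \<P>(\<omega> in M r. \<bar>Y r \<omega>\<bar> > \<delta> / 2)) \<longlonglongrightarrow> 0 + 0"
    using X Y half_gt_zero[OF \<delta>] unfolding conv_in_probability_0_def by (intro tendsto_add) blast+
  have "\<P>(\<omega> in M r. \<bar>X r \<omega> + Y r \<omega>\<bar> > \<delta>) \<le> \<P>(\<omega> in M r. \<bar>X r \<omega>\<bar> > \<delta> / 2) + \<P>(\<omega> in M r. \<bar>Y r \<omega>\<bar> > \<delta> / 2)" for r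
  proof -
    interpret prob_space "M r" by (rule M)
    have "\<P>(\<omega> in M r. \<bar>X r \<omega> + Y r \<omega>\<bar> > \<delta>)
            \<le> prob ({\<omega>\<in>space (M r). \<bar>X r \<omega>\<bar> > \<delta> / 2} \<union> {\<omega>\<in>space (M r). \<bar>Y r \<omega>\<bar> > \<delta> / 2})"
      by (rule finite_measure_mono) auto
    also have "\<dots> \<le> \<P>(\<omega> in M r. \<bar>X r \<omega>\<bar> > \<delta> / 2) + \<P>(\<omega> in M r. \<bar>Y r \<omega>\<bar> > \<delta> / 2)"
      by (rule measure_Un_le) auto
    finally show ?thesis .
  qed
  then show "(\<lambda>r. \<P>(\<omega> in M r. \<bar>X r \<omega> + Y r \<omega>\<bar> > \<delta>)) \<longlonglongrightarrow> 0"
    using lim by (intro tendsto_sandwich[OF _ _ tendsto_const lim[simplified]]) auto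
qed

lemma expectation_min_1_tendsto_0:
  assumes M: "\<And>r. prob_space (M r)" and m: "\<And>r. Z r \<in> borel_measurable (M r)"
    and nonneg: "\<And>r \<omega>. 0 \<le> Z r \<omega>" and Z: "conv_in_probability_0 M Z"
  shows "(\<lambda>r. \<integral>\<omega>. min 1 (Z r \<omega>) \<partial>M r) \<longlonglongrightarrow> 0"
proof (rule order_tendstoI)
  fix \<eta> :: real assume \<eta>: "0 < \<eta>"
  note [measurable] = m
  have "(\<lambda>r. \<P>(\<omega> in M r. \<bar>Z r \<omega>\<bar> > \<eta> / 2)) \<longlonglongrightarrow> 0"
    using Z half_gt_zero[OF \<eta>] unfolding conv_in_probability_0_def by blast
  then have "\<forall>\<^sub>F r in sequentially. \<P>(\<omega> in M r. \<bar>Z r \<omega>\<bar> > \<eta> / 2) < \<eta> / 2"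
    using \<eta> by (intro order_tendstoD) auto
  then show "\<forall>\<^sub>F r in sequentially. (\<integral>\<omega>. min 1 (Z r \<omega>) \<partial>M r) < \<eta>"
  proof eventually_elim
    case (elim r)
    interpret prob_space "M r" by (rule M)
    let ?A = "{\<omega>\<in>space (M r). \<bar>Z r \<omega>\<bar> > \<eta> / 2}"
    have "expectation (\<lambda>\<omega>. min 1 (Z r \<omega>)) \<le> expectation (\<lambda>\<omega>. \<eta> / 2 + indicator ?A \<omega>)"
      using nonneg \<eta>
      by (intro integral_mono Bochner_Integration.integrable_add integrable_const
            integrable_const_bound[where B=1]) (auto simp: indicator_def)
    also have "\<dots> = \<eta> / 2 + prob ?A"
      by (subst Bochner_Integration.integral_add) (auto simp: prob_space less_top[symmetric])
    finally show ?case using elim by simp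
  qed
next
  fix a :: real assume "a < 0"
  moreover have "0 \<le> (\<integral>\<omega>. min 1 (Z r \<omega>) \<partial>M r)" for r using nonneg by simp
  ultimately show "\<forall>\<^sub>F r in sequentially. a < (\<integral>\<omega>. min 1 (Z r \<omega>) \<partial>M r)"
    by (intro always_eventually allI) (rule less_le_trans)
qed

section \<open>State space collapse\<close>

context swapping_network
begin

text \<open>
  A gap above \<open>\<epsilon>\<close> between two stations forces the spread to be at least \<open>c * \<epsilon>\<^sup>2\<close>, so this is the level
  at which the hitting bound for the spread is applied.
\<close>

lemma coordinate_gap_tendsto_0:
  obtains \<kappa> c :: real where "0 < \<kappa>" "0 < c"
    "\<And>(M :: nat \<Rightarrow> 'w measure) Q b t0 T \<epsilon> i j.
       (\<And>r. markov_jump_process (M r) (Q r) (rates r)) \<Longrightarrow> 0 < T \<Longrightarrow> 0 < \<epsilon> \<Longrightarrow>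
       \<forall>\<^sub>F r in sequentially. 1 \<le> b r \<Longrightarrow> \<forall>\<^sub>F r in sequentially. 0 \<le> t0 r \<Longrightarrow>
       conv_in_probability_0 M (\<lambda>r \<omega>. 1 / b r ^ 4 * (V r (Q r 0 \<omega>))\<^sup>2 + 4 * lam / mu / real r * G r (Q r 0 \<omega>)
          + exp (- (\<kappa> * sqrt (real r) / b r) * t0 r) * (1 / (c * \<epsilon>\<^sup>2)\<^sup>2 * (V r (Q r 0 \<omega>))\<^sup>2)) \<Longrightarrow>
       (\<lambda>r. \<P>(\<omega> in M r. (SUP t\<in>{t0 r..T}. ereal \<bar>q r (Q r t \<omega>) i - q r (Q r t \<omega>) j\<bar>) > ereal \<epsilon>)) \<longlonglongrightarrow> 0"
proof -
  obtain \<kappa> C where \<kappa>: "0 < \<kappa>" "0 < C" and hit: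
    "\<And>r b \<epsilon> t0 T (M :: 'w measure) X. 0 < r \<Longrightarrow> 1 \<le> b \<Longrightarrow> 0 < \<epsilon> \<Longrightarrow> 0 \<le> t0 \<Longrightarrow> 0 < T \<Longrightarrow>
       markov_jump_process M X (rates r) \<Longrightarrow>
       \<exists>E\<in>sets M. {\<omega>\<in>space M. \<exists>t\<in>{t0..<T}. \<epsilon> \<le> V r (X t \<omega>)} \<subseteq> E \<and>
         measure M E \<le> (\<integral>\<omega>. min 1 (1 / b ^ 4 * (V r (X 0 \<omega>))\<^sup>2 + 4 * lam / mu / real r * G r (X 0 \<omega>)
             + exp (- (\<kappa> * sqrt (real r) / b) * t0) * (1 / \<epsilon>\<^sup>2 * (V r (X 0 \<omega>))\<^sup>2)) \<partial>M)
           + C / sqrt (real r) * (1 + 1 / \<epsilon>\<^sup>2) * T"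
    using spread_hitting by blast
  obtain c where c: "0 < c" "\<And>f i j. c * (f i - f j)\<^sup>2 \<le> spread f"
    using sq_diff_le_spread by blast
  show ?thesis
  proof (rule that[OF \<kappa>(1) c(1)])
    fix M :: "nat \<Rightarrow> 'w measure" and Q :: "nat \<Rightarrow> real \<Rightarrow> 'w \<Rightarrow> nat ^ 's" and b t0 and T \<epsilon> :: real and i j
    define Z where "Z r \<omega> = 1 / b r ^ 4 * (V r (Q r 0 \<omega>))\<^sup>2 + 4 * lam / mu / real r * G r (Q r 0 \<omega>)
          + exp (- (\<kappa> * sqrt (real r) / b r) * t0 r) * (1 / (c * \<epsilon>\<^sup>2)\<^sup>2 * (V r (Q r 0 \<omega>))\<^sup>2)" for r \<omega>
    assume Q: "\<And>r. markov_jump_process (M r) (Q r) (rates r)" and T: "0 < T" and \<epsilon>: "0 < \<epsilon>"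
      and b: "\<forall>\<^sub>F r in sequentially. 1 \<le> b r" and t0: "\<forall>\<^sub>F r in sequentially. 0 \<le> t0 r"
      and Z: "conv_in_probability_0 M (\<lambda>r \<omega>. 1 / b r ^ 4 * (V r (Q r 0 \<omega>))\<^sup>2 + 4 * lam / mu / real r * G r (Q r 0 \<omega>)
          + exp (- (\<kappa> * sqrt (real r) / b r) * t0 r) * (1 / (c * \<epsilon>\<^sup>2)\<^sup>2 * (V r (Q r 0 \<omega>))\<^sup>2))"
    let ?D = "\<lambda>r. {\<omega>\<in>space (M r). (SUP t\<in>{t0 r..T}. ereal \<bar>q r (Q r t \<omega>) i - q r (Q r t \<omega>) j\<bar>) > ereal \<epsilon>}"
    let ?C = "C * (1 + 1 / (c * \<epsilon>\<^sup>2)\<^sup>2) * (T + 1)"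
    have M: "prob_space (M r)" for r using Q[of r] by (simp add: markov_jump_process_def)
    have Qm: "Q r 0 \<in> measurable (M r) (count_space UNIV)" for r
      using Q[of r] by (simp add: markov_jump_process_def)
    have "(\<lambda>r. \<integral>\<omega>. min 1 (Z r \<omega>) \<partial>M r) \<longlonglongrightarrow> 0"
    proof (rule expectation_min_1_tendsto_0[OF M])
      show "Z r \<in> borel_measurable (M r)" for r
        unfolding Z_def by (rule measurable_compose[OF Qm]) simp
      show "0 \<le> Z r \<omega>" for r \<omega>
        unfolding Z_def using lam mu excess_nonneg by (intro add_nonneg_nonneg mult_nonneg_nonneg) auto
      show "conv_in_probability_0 M Z" using Z by (simp add: Z_def[abs_def])
    qed
    moreover have "(\<lambda>r. ?C / sqrt (real r)) \<longlonglongrightarrow> 0"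
      by (intro real_tendsto_divide_at_top[OF tendsto_const]
            filterlim_compose[OF sqrt_at_top] filterlim_real_sequentially)
    ultimately have lim: "(\<lambda>r. (\<integral>\<omega>. min 1 (Z r \<omega>) \<partial>M r) + ?C / sqrt (real r)) \<longlonglongrightarrow> 0"
      using tendsto_add by fastforce
    have "\<forall>\<^sub>F r in sequentially. measure (M r) (?D r) \<le> (\<integral>\<omega>. min 1 (Z r \<omega>) \<partial>M r) + ?C / sqrt (real r)"
      using b t0 eventually_gt_at_top[of 0]
    proof eventually_elim
      case (elim r)
      interpret prob_space "M r" by (rule M)
      have \<epsilon>': "0 < c * \<epsilon>\<^sup>2" using c \<epsilon> by simp
      have T1: "0 < T + 1" using T by simp
      obtain E where E: "E \<in> sets (M r)"
        "{\<omega>\<in>space (M r). \<exists>t\<in>{t0 r..<T + 1}. c * \<epsilon>\<^sup>2 \<le> V r (Q r t \<omega>)} \<subseteq> E"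
        "prob E \<le> expectation (\<lambda>\<omega>. min 1 (Z r \<omega>)) + C / sqrt (real r) * (1 + 1 / (c * \<epsilon>\<^sup>2)\<^sup>2) * (T + 1)"
        using hit[OF elim(3,1) \<epsilon>' elim(2) T1 Q] unfolding Z_def by blast
      have "?D r \<subseteq> E"
      proof
        fix \<omega> assume "\<omega> \<in> ?D r"
        then obtain t where \<omega>: "\<omega> \<in> space (M r)" and t: "t \<in> {t0 r..T}"
          and gap: "\<epsilon> < \<bar>q r (Q r t \<omega>) i - q r (Q r t \<omega>) j\<bar>"
          by (auto simp: less_SUP_iff)
        have "\<epsilon>\<^sup>2 \<le> (q r (Q r t \<omega>) i - q r (Q r t \<omega>) j)\<^sup>2"
          using gap \<epsilon> by (intro abs_le_square_iff[THEN iffD1]) auto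
        then have "c * \<epsilon>\<^sup>2 \<le> V r (Q r t \<omega>)"
          using c by (meson less_imp_le mult_left_mono order_trans)
        then show "\<omega> \<in> E" using E(2) \<omega> t by force
      qed
      then have "prob (?D r) \<le> prob E" using E(1) by (rule finite_measure_mono)
      then show ?case using E(3) by simp
    qed
    then show "(\<lambda>r. measure (M r) (?D r)) \<longlonglongrightarrow> 0"
      by (intro tendsto_sandwich[OF _ _ tendsto_const lim]) auto
  qed
qed

lemma spread_sq_bounded: "\<exists>C. \<forall>y :: real ^ 's. norm y \<le> R \<longrightarrow> \<bar>(spread (($) y))\<^sup>2\<bar> \<le> C"
proof (intro exI allI impI)
  fix y :: "real ^ 's" assume y: "norm y \<le> R"
  have "\<bar>y $ i - y $ j\<bar> \<le> 2 * R" for i j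
    using component_le_norm_cart[of y i] component_le_norm_cart[of y j] y by linarith
  then have "spread (($) y) \<le> (2 * R)\<^sup>2" by (rule spread_le_of_gaps)
  from power_mono[OF this spread_nonneg, of 2] show "\<bar>(spread (($) y))\<^sup>2\<bar> \<le> ((2 * R)\<^sup>2)\<^sup>2" by simp
qed

lemma excess_bounded: "\<exists>C. \<forall>y :: real ^ 's. norm y \<le> R \<longrightarrow> \<bar>excess (($) y)\<bar> \<le> C"
proof (intro exI allI impI)
  fix y :: "real ^ 's" assume y: "norm y \<le> R"
  have "(max 0 (y $ i - \<gamma>))\<^sup>2 \<le> (R + \<bar>\<gamma>\<bar>)\<^sup>2" for i
    using component_le_norm_cart[of y i] y by (intro power_mono) auto
  then have "excess (($) y) \<le> (\<Sum>i\<in>UNIV. w i * (R + \<bar>\<gamma>\<bar>)\<^sup>2)"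
    unfolding excess_def using w_pos by (intro sum_mono mult_left_mono) (auto simp: less_imp_le)
  then show "\<bar>excess (($) y)\<bar> \<le> (R + \<bar>\<gamma>\<bar>)\<^sup>2"
    using excess_nonneg by (simp add: sum_distrib_right[symmetric] sum_w)
qed

end

theorem theorem4p5:
  fixes p :: "'s::finite set \<Rightarrow> real"
    and lam mu \<beta> \<gamma> :: real
    and M :: "nat \<Rightarrow> 'w measure"
    and Q :: "nat \<Rightarrow> real \<Rightarrow> 'w \<Rightarrow> nat ^ 's"
    and Qhat :: "nat \<Rightarrow> real \<Rightarrow> 'w \<Rightarrow> real ^ 's"
    and N :: "'v measure"
    and Qhat0 :: "'v \<Rightarrow> real ^ 's"
  assumes "CARD('s) \<ge> 2"
    and "lam > 0" and "mu > 0" and "\<gamma> \<le> \<beta>"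
    and "\<And>e. e \<in> station_pairs \<Longrightarrow> p e \<ge> 0"
    and "(\<Sum>e\<in>station_pairs. p e) = 1"
    and "pair_graph_connected p"
    and "\<And>r. markov_jump_process (M r) (Q r) (queue_rates p lam mu \<beta> \<gamma> r)"
    and "\<And>r t \<omega>. Qhat r t \<omega> = diffusion_scaled p lam mu r (Q r t \<omega>)"
    and "prob_space N" and "Qhat0 \<in> borel_measurable N"
    and "conv_in_distribution M (\<lambda>r. Qhat r 0) N Qhat0"
  shows "(\<forall>K :: nat \<Rightarrow> real. K \<in> o(\<lambda>r. sqrt (real r)) \<and> filterlim K at_top sequentially \<longrightarrow>
            (\<forall>T>0. \<forall>\<epsilon>>0. \<forall>i j.
               (\<lambda>r. \<P>(\<omega> in M r.
                  (SUP t\<in>{K r / sqrt (real r)..T}. ereal \<bar>Qhat r t \<omega> $ i - Qhat r t \<omega> $ j\<bar>) > ereal \<epsilon>))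
               \<longlonglongrightarrow> 0))
       \<and> ((\<forall>i j. conv_in_probability_0 M (\<lambda>r \<omega>. \<bar>Qhat r 0 \<omega> $ i - Qhat r 0 \<omega> $ j\<bar>)) \<longrightarrow>
            (\<forall>T>0. \<forall>\<epsilon>>0. \<forall>i j.
               (\<lambda>r. \<P>(\<omega> in M r.
                  (SUP t\<in>{0..T}. ereal \<bar>Qhat r t \<omega> $ i - Qhat r t \<omega> $ j\<bar>) > ereal \<epsilon>))
               \<longlonglongrightarrow> 0))"
proof -
  interpret swapping_network p lam mu \<beta> \<gamma>
    by unfold_locales (fact assms(1-7))+
  have Q: "markov_jump_process (M r) (Q r) (rates r)" for r by (rule assms(8))
  have M: "prob_space (M r)" for r using Q[of r] by (simp add: markov_jump_process_def)
  have Qm: "Q r 0 \<in> measurable (M r) (count_space UNIV)" for r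
    using Q[of r] by (simp add: markov_jump_process_def)
  have meas: "(\<lambda>\<omega>. g (Q r 0 \<omega>)) \<in> borel_measurable (M r)" for r and g :: "nat ^ 's \<Rightarrow> 'c::topological_space"
    by (rule measurable_compose[OF Qm]) simp
  have Qhat: "Qhat r t \<omega> = diffusion_scaled p lam mu r (Q r t \<omega>)" for r t \<omega> by (rule assms(9))
  have Ym: "Qhat r 0 \<in> borel_measurable (M r)" for r
    using meas[of "diffusion_scaled p lam mu r"] by (simp add: Qhat[abs_def])
  have tight: "\<exists>R. \<forall>\<^sub>F r in sequentially. \<P>(\<omega> in M r. R < norm (Qhat r 0 \<omega>)) < \<eta>" if "0 < \<eta>" for \<eta>
    by (rule conv_in_distribution_tight[OF M Ym assms(10-12) that])
  have small_V: "conv_in_probability_0 M (\<lambda>r \<omega>. a r * (V r (Q r 0 \<omega>))\<^sup>2)" if "a \<longlonglongrightarrow> 0" for a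
    using conv_in_probability_0_scaled_tight[OF M Ym tight spread_sq_bounded that] by (simp add: Qhat)
  have small_G: "conv_in_probability_0 M (\<lambda>r \<omega>. a r * G r (Q r 0 \<omega>))" if "a \<longlonglongrightarrow> 0" for a
    using conv_in_probability_0_scaled_tight[OF M Ym tight excess_bounded that] by (simp add: Qhat)
  obtain \<kappa> c :: real where \<kappa>: "0 < \<kappa>" and c: "0 < c" and gap:
    "\<And>(M :: nat \<Rightarrow> 'w measure) Q b t0 T \<epsilon> i j.
       (\<And>r. markov_jump_process (M r) (Q r) (rates r)) \<Longrightarrow> 0 < T \<Longrightarrow> 0 < \<epsilon> \<Longrightarrow>
       \<forall>\<^sub>F r in sequentially. 1 \<le> b r \<Longrightarrow> \<forall>\<^sub>F r in sequentially. 0 \<le> t0 r \<Longrightarrow>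
       conv_in_probability_0 M (\<lambda>r \<omega>. 1 / b r ^ 4 * (V r (Q r 0 \<omega>))\<^sup>2 + 4 * lam / mu / real r * G r (Q r 0 \<omega>)
          + exp (- (\<kappa> * sqrt (real r) / b r) * t0 r) * (1 / (c * \<epsilon>\<^sup>2)\<^sup>2 * (V r (Q r 0 \<omega>))\<^sup>2)) \<Longrightarrow>
       (\<lambda>r. \<P>(\<omega> in M r. (SUP t\<in>{t0 r..T}. ereal \<bar>q r (Q r t \<omega>) i - q r (Q r t \<omega>) j\<bar>) > ereal \<epsilon>)) \<longlonglongrightarrow> 0"
    using coordinate_gap_tendsto_0 by blast
  have collapse: "(\<lambda>r. \<P>(\<omega> in M r. (SUP t\<in>{t0 r..T}. ereal \<bar>Qhat r t \<omega> $ i - Qhat r t \<omega> $ j\<bar>) > ereal \<epsilon>)) \<longlonglongrightarrow> 0"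
    if T: "0 < T" and \<epsilon>: "0 < \<epsilon>" and b: "filterlim b at_top sequentially"
      and t0: "\<forall>\<^sub>F r in sequentially. 0 \<le> t0 r"
      and start: "conv_in_probability_0 M (\<lambda>r \<omega>. exp (- (\<kappa> * sqrt (real r) / b r) * t0 r)
             * (1 / (c * \<epsilon>\<^sup>2)\<^sup>2 * (V r (Q r 0 \<omega>))\<^sup>2))"
    for T \<epsilon> b t0 i j
    unfolding Qhat
  proof (rule gap[OF Q T \<epsilon> _ t0])
    show "\<forall>\<^sub>F r in sequentially. 1 \<le> b r" using b by (simp add: filterlim_at_top)
    have "(\<lambda>r. 1 / b r ^ 4) \<longlonglongrightarrow> 0"
      by (intro real_tendsto_divide_at_top[OF tendsto_const] filterlim_pow_at_top b) simp
    moreover have "(\<lambda>r. 4 * lam / mu / real r) \<longlonglongrightarrow> 0"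
      by (intro real_tendsto_divide_at_top[OF tendsto_const] filterlim_real_sequentially)
    ultimately show "conv_in_probability_0 M (\<lambda>r \<omega>. 1 / b r ^ 4 * (V r (Q r 0 \<omega>))\<^sup>2
          + 4 * lam / mu / real r * G r (Q r 0 \<omega>)
          + exp (- (\<kappa> * sqrt (real r) / b r) * t0 r) * (1 / (c * \<epsilon>\<^sup>2)\<^sup>2 * (V r (Q r 0 \<omega>))\<^sup>2))"
      by (intro conv_in_probability_0_add[OF M] small_V small_G start meas)
  qed
  show ?thesis
  proof (intro conjI allI impI)
    fix K :: "nat \<Rightarrow> real" and T \<epsilon> :: real and i j
    assume K: "K \<in> o(\<lambda>r. sqrt (real r)) \<and> filterlim K at_top sequentially" and T: "0 < T" and \<epsilon>: "0 < \<epsilon>"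
    have Kpos: "\<forall>\<^sub>F r in sequentially. 0 < K r" using K by (simp add: filterlim_at_top_dense)
    have sqrtK: "filterlim (\<lambda>r. sqrt (K r)) at_top sequentially"
      using K by (intro filterlim_compose[OF sqrt_at_top]) simp
    show "(\<lambda>r. \<P>(\<omega> in M r. (SUP t\<in>{K r / sqrt (real r)..T}. ereal \<bar>Qhat r t \<omega> $ i - Qhat r t \<omega> $ j\<bar>) > ereal \<epsilon>))
            \<longlonglongrightarrow> 0"
    \<comment> \<open>With $b = \sqrt{K^r}$ the decay over the time $K^r/\sqrt r$ is $e^{-\kappa \sqrt{K^r}}$.\<close>
    proof (rule collapse[OF T \<epsilon> sqrtK])
      show "\<forall>\<^sub>F r in sequentially. 0 \<le> K r / sqrt (real r)"
        using Kpos by eventually_elim simp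
      have "filterlim (\<lambda>r. - (\<kappa> * sqrt (K r))) at_bot sequentially"
        using \<kappa> sqrtK by (simp add: filterlim_uminus_at_bot filterlim_tendsto_pos_mult_at_top[OF tendsto_const])
      then have "(\<lambda>r. exp (- (\<kappa> * sqrt (K r)))) \<longlonglongrightarrow> 0"
        by (rule filterlim_compose[OF exp_at_bot])
      moreover have "\<forall>\<^sub>F r in sequentially. exp (- (\<kappa> * sqrt (K r)))
            = exp (- (\<kappa> * sqrt (real r) / sqrt (K r)) * (K r / sqrt (real r)))"
        using Kpos eventually_gt_at_top[of 0]
      proof eventually_elim
        case (elim r)
        have "\<kappa> * sqrt (real r) / sqrt (K r) * (K r / sqrt (real r)) = \<kappa> * (K r / sqrt (K r))"
          using elim by simp
        also have "\<dots> = \<kappa> * sqrt (K r)" using elim by (simp only: real_div_sqrt less_imp_le)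
        finally show ?case by simp
      qed
      ultimately have "(\<lambda>r. exp (- (\<kappa> * sqrt (real r) / sqrt (K r)) * (K r / sqrt (real r)))) \<longlonglongrightarrow> 0"
        by (rule Lim_transform_eventually)
      from tendsto_mult_right[OF this, of "1 / (c * \<epsilon>\<^sup>2)\<^sup>2"]
      show "conv_in_probability_0 M (\<lambda>r \<omega>. exp (- (\<kappa> * sqrt (real r) / sqrt (K r)) * (K r / sqrt (real r)))
             * (1 / (c * \<epsilon>\<^sup>2)\<^sup>2 * (V r (Q r 0 \<omega>))\<^sup>2))"
        unfolding mult.assoc[symmetric] by (intro small_V) simp
    qed
  next
    fix T \<epsilon> :: real and i j
    assume start: "\<forall>i j. conv_in_probability_0 M (\<lambda>r \<omega>. \<bar>Qhat r 0 \<omega> $ i - Qhat r 0 \<omega> $ j\<bar>)"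
      and T: "0 < T" and \<epsilon>: "0 < \<epsilon>"
    define k where "k = 1 / (c * \<epsilon>\<^sup>2)\<^sup>2"
    have k: "0 < k" using c \<epsilon> by (simp add: k_def)
    show "(\<lambda>r. \<P>(\<omega> in M r. (SUP t\<in>{0..T}. ereal \<bar>Qhat r t \<omega> $ i - Qhat r t \<omega> $ j\<bar>) > ereal \<epsilon>)) \<longlonglongrightarrow> 0"
    \<comment> \<open>Without an initial period nothing has to decay, and any $b$ that tends to infinity will do.\<close>
    proof (rule collapse[OF T \<epsilon> filterlim_real_sequentially])
      have "conv_in_probability_0 M (\<lambda>r \<omega>. k * (V r (Q r 0 \<omega>))\<^sup>2)"
        unfolding conv_in_probability_0_def
      proof (intro allI impI)
        fix \<delta> :: real assume \<delta>: "0 < \<delta>"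
        \<comment> \<open>If all gaps are at most \<open>d\<close>, then $V^2 \le d^4 \le d \le \delta/k$.\<close>
        define d where "d = min 1 (\<delta> / k)"
        have d: "0 < d" "k * d ^ 4 \<le> \<delta>"
        proof -
          show "0 < d" using \<delta> k by (simp add: d_def)
          then have "d ^ 4 \<le> d ^ 1" by (intro power_decreasing) (auto simp: d_def)
          also have "\<dots> \<le> \<delta> / k" by (simp add: d_def)
          finally show "k * d ^ 4 \<le> \<delta>" using k by (simp add: field_simps)
        qed
        have "\<P>(\<omega> in M r. \<bar>k * (V r (Q r 0 \<omega>))\<^sup>2\<bar> > \<delta>)
                \<le> (\<Sum>i\<in>UNIV. \<Sum>j\<in>UNIV. \<P>(\<omega> in M r. \<bar>\<bar>Qhat r 0 \<omega> $ i - Qhat r 0 \<omega> $ j\<bar>\<bar> > d))" for r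
        proof -
          interpret prob_space "M r" by (rule M)
          define A where "A = (\<lambda>(i, j). {\<omega>\<in>space (M r). \<bar>\<bar>Qhat r 0 \<omega> $ i - Qhat r 0 \<omega> $ j\<bar>\<bar> > d})"
          have A: "A x \<in> events" for x
            using meas[of "\<lambda>y. \<bar>\<bar>diffusion_scaled p lam mu r y $ fst x - diffusion_scaled p lam mu r y $ snd x\<bar>\<bar>" r]
            by (auto simp: A_def split_def Qhat)
          have "{\<omega>\<in>space (M r). \<bar>k * (V r (Q r 0 \<omega>))\<^sup>2\<bar> > \<delta>} \<subseteq> (\<Union>x\<in>UNIV. A x)"
          proof (rule subsetI, rule ccontr)
            fix \<omega> assume \<omega>: "\<omega> \<in> {\<omega>\<in>space (M r). \<bar>k * (V r (Q r 0 \<omega>))\<^sup>2\<bar> > \<delta>}" "\<omega> \<notin> (\<Union>x\<in>UNIV. A x)"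
            then have "\<bar>q r (Q r 0 \<omega>) i - q r (Q r 0 \<omega>) j\<bar> \<le> d" for i j
              by (auto simp: A_def Qhat not_less)
            then have "V r (Q r 0 \<omega>) \<le> d\<^sup>2" by (rule spread_le_of_gaps)
            from power_mono[OF this spread_nonneg, of 2] have "(V r (Q r 0 \<omega>))\<^sup>2 \<le> d ^ 4"
              by (simp add: power_mult[symmetric])
            then have "k * (V r (Q r 0 \<omega>))\<^sup>2 \<le> k * d ^ 4" using k by simp
            moreover have "\<delta> < k * (V r (Q r 0 \<omega>))\<^sup>2" using \<omega>(1) k by simp
            ultimately show False using d by linarith
          qed
          then have "prob {\<omega>\<in>space (M r). \<bar>k * (V r (Q r 0 \<omega>))\<^sup>2\<bar> > \<delta>} \<le> prob (\<Union>x\<in>UNIV. A x)"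
            using A by (intro finite_measure_mono) auto
          also have "\<dots> \<le> (\<Sum>x\<in>UNIV. prob (A x))"
            using A by (intro measure_UNION_le) auto
          also have "\<dots> = (\<Sum>i\<in>UNIV. \<Sum>j\<in>UNIV. prob (A (i, j)))"
            unfolding UNIV_Times_UNIV[symmetric] by (simp add: sum.cartesian_product)
          finally show ?thesis by (simp add: A_def)
        qed
        moreover have lim: "(\<lambda>r. \<Sum>i\<in>UNIV. \<Sum>j\<in>UNIV. \<P>(\<omega> in M r. \<bar>\<bar>Qhat r 0 \<omega> $ i - Qhat r 0 \<omega> $ j\<bar>\<bar> > d)) \<longlonglongrightarrow> (\<Sum>i\<in>(UNIV :: 's set). \<Sum>j\<in>(UNIV :: 's set). 0)"
          using start d unfolding conv_in_probability_0_def by (intro tendsto_sum) auto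
        ultimately show "(\<lambda>r. \<P>(\<omega> in M r. \<bar>k * (V r (Q r 0 \<omega>))\<^sup>2\<bar> > \<delta>)) \<longlonglongrightarrow> 0"
          by (intro tendsto_sandwich[OF _ _ tendsto_const lim[simplified]]) auto
      qed
      then show "conv_in_probability_0 M (\<lambda>r \<omega>. exp (- (\<kappa> * sqrt (real r) / real r) * 0)
             * (1 / (c * \<epsilon>\<^sup>2)\<^sup>2 * (V r (Q r 0 \<omega>))\<^sup>2))"
        by (simp add: k_def)
    qed simp
  qed
qed

end
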